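(* Let $(k_1,\dots,k_n)\in\mathbb{Z}^n$ be arbitrary. The (signed) generating function of extended arrowed monotone triangles with bottom row $(k_1,\dots,k_n)$ equals $$\prod_{i=1}^n\left(\omega(\nearrow)X_i+\omega(\nwarrow)X_i^{-1}+\omega(\nwarrow\!\nearrow)+\omega(\emptyset)\right)\prod_{1\le p<q\le n}\left(\omega(\nearrow)E_{k_p}+\omega(\nwarrow)E_{k_q}^{-1}+\omega(\nwarrow\!\nearrow)E_{k_p}E_{k_q}^{-1}+\omega(\emptyset)\,\mathrm{id}\right)s_{(k_n,\dots,k_1)}(X_1,\dots,X_n),$$ with the operator product expanded and applied to $(k_1,\dots,k_n)\mapsto s_{(k_n,\dots,k_1)}$ as a function on $\mathbb{Z}^n$ before evaluation.
   Context: Signed interval for $a,b\in\mathbb{Z}$: $\langle a,b\rangle=([a,b],\emptyset)$ if $a\le b$; $=(\emptyset,[b+1,a-1])$ if $b+1\le a-1$; $=(\emptyset,\emptyset)$ if $b+1=a$; the interval is negative iff its positive part is empty and its negative part nonempty, and "$x\in\langle a,b\rangle$" means $x$ lies in the positive or negative part. An extended arrowed monotone triangle is a triangular array $(a_{i,j})_{1\le j\le i\le n}$ of integers, each decorated with an element of $\{\nwarrow,\nearrow,\nwarrow\!\nearrow,\emptyset\}$, such that for every $a=a_{i,j}$ with $i<n$, with $b=a_{i+1,j}$, $c=a_{i+1,j+1}$: $a\in\langle b+\epsilon_b,\,c-\delta_c\rangle$, where $\epsilon_b=1$ if $b$ carries $\nearrow$ or $\nwarrow\!\nearrow$ and $0$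 otherwise, and $\delta_c=1$ if $c$ carries $\nwarrow$ or $\nwarrow\!\nearrow$ and $0$ otherwise. Its sign is $(-1)^N$ where $N$ is the number of pairs $(i,j)$, $2\le i\le n$, $j<i$, for which the interval $\langle a_{i,j}+\epsilon_{a_{i,j}},a_{i,j+1}-\delta_{a_{i,j+1}}\rangle$ is negative. Its weight is $\omega(\nearrow)^{\#\nearrow}\omega(\nwarrow)^{\#\nwarrow}\omega(\nwarrow\!\nearrow)^{\#\nwarrow\nearrow}\omega(\emptyset)^{\#\emptyset}\prod_iX_i^{\sum_ja_{i,j}-\sum_ja_{i-1,j}+\#\nearrow\text{ in row }i-\#\nwarrow\text{ in row }i}$; the generating function is the sum of sign times weight. $E_x$ is the shift $E_xp(x)=p(x+1)$. Extended Schur polynomial: for $\lambda\in\mathbb{Z}^n$, $s_\lambda=0$ if $\lambda_i-i=\lambda_j-j$ for some $i<j$; else with $\sigma$ such that $\lambda_{\sigma(1)}-\sigma(1)>\dots>\lambda_{\sigma(n)}-\sigma(n)$ and integer $p\ge0$ with $\lambda_{\sigma(n)}+n-\sigma(n)+p\ge0$, $s_\lambda=\operatorname{sgn}(\sigma)s_\mu\prod X_i^{-p}$, $\mu_i=\lambda_{\sigma(i)}+i-\sigma(i)+p$. *)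

theory Defs
  imports Main "HOL-Combinatorics.Permutations"
begin

datatype arrow = NE | NW | NWNE | Empty

definition eps :: "arrow \<Rightarrow> int" where
  "eps d = (if d = NE \<or> d = NWNE then 1 else 0)"

definition delta :: "arrow \<Rightarrow> int" where
  "delta d = (if d = NW \<or> d = NWNE then 1 else 0)"

definition in_sint :: "int \<Rightarrow> int \<Rightarrow> int \<Rightarrow> bool" where
  "in_sint x a b = ((a \<le> b \<and> a \<le> x \<and> x \<le> b) \<or> (b + 1 \<le> a - 1 \<and> b + 1 \<le> x \<and> x \<le> a - 1))"

definition neg_sint :: "int \<Rightarrow> int \<Rightarrow> bool" where
  "neg_sint a b = (\<not> a \<le> b \<and> b + 1 \<le> a - 1)"

text \<open>A triangle is a pair (a, d): a i j is the entry and d i j its decoration, for 1 \<le> j \<le> i \<le> n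
  (row n is the bottom row). Outside this index range the functions are fixed to 0 / Empty.\<close>

definition cells :: "nat \<Rightarrow> (nat \<times> nat) set" where
  "cells n = {(i, j). 1 \<le> j \<and> j \<le> i \<and> i \<le> n}"

definition ext_arrowed_MT :: "nat \<Rightarrow> (nat \<Rightarrow> int) \<Rightarrow>
    ((nat \<Rightarrow> nat \<Rightarrow> int) \<times> (nat \<Rightarrow> nat \<Rightarrow> arrow)) set" where
  "ext_arrowed_MT n k = {(a, d).
      (\<forall>i j. (i, j) \<notin> cells n \<longrightarrow> a i j = 0 \<and> d i j = Empty) \<and>
      (\<forall>j. 1 \<le> j \<and> j \<le> n \<longrightarrow> a n j = k j) \<and>
      (\<forall>i j. 1 \<le> j \<and> j \<le> i \<and> i < n \<longrightarrow>
          in_sint (a i j) (a (Suc i) j + eps (d (Suc i) j))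
                          (a (Suc i) (Suc j) - delta (d (Suc i) (Suc j))))}"

definition neg_count :: "nat \<Rightarrow> (nat \<Rightarrow> nat \<Rightarrow> int) \<Rightarrow> (nat \<Rightarrow> nat \<Rightarrow> arrow) \<Rightarrow> nat" where
  "neg_count n a d = card {(i, j). 2 \<le> i \<and> i \<le> n \<and> 1 \<le> j \<and> j < i \<and>
      neg_sint (a i j + eps (d i j)) (a i (Suc j) - delta (d i (Suc j)))}"

definition row_sum :: "(nat \<Rightarrow> nat \<Rightarrow> int) \<Rightarrow> nat \<Rightarrow> int" where
  "row_sum a i = (\<Sum>j = 1..i. a i j)"

definition count_arrow :: "(nat \<Rightarrow> nat \<Rightarrow> arrow) \<Rightarrow> nat \<Rightarrow> arrow \<Rightarrow> int" where
  "count_arrow d i e = int (card {j. 1 \<le> j \<and> j \<le> i \<and> d i j = e})"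

definition tri_weight :: "nat \<Rightarrow> (arrow \<Rightarrow> 'a::field) \<Rightarrow> (nat \<Rightarrow> 'a) \<Rightarrow>
    (nat \<Rightarrow> nat \<Rightarrow> int) \<Rightarrow> (nat \<Rightarrow> nat \<Rightarrow> arrow) \<Rightarrow> 'a" where
  "tri_weight n \<omega> X a d =
     (\<Prod>(i, j) \<in> cells n. \<omega> (d i j)) *
     (\<Prod>i = 1..n. X i powi (row_sum a i - row_sum a (i - 1)
                              + count_arrow d i NE - count_arrow d i NW))"

definition gen_fun :: "nat \<Rightarrow> (arrow \<Rightarrow> 'a::field) \<Rightarrow> (nat \<Rightarrow> 'a) \<Rightarrow> (nat \<Rightarrow> int) \<Rightarrow> 'a" where
  "gen_fun n \<omega> X k = (\<Sum>(a, d) \<in> ext_arrowed_MT n k.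
      (- 1) ^ neg_count n a d * tri_weight n \<omega> X a d)"

text \<open>Semistandard Young tableaux of shape mu (a partition with at most n parts, mu 1 \<ge> ... \<ge> mu n)
  with entries in {1..n}; T r c is the entry in row r, column c (0 outside the diagram).\<close>
definition SSYT :: "nat \<Rightarrow> (nat \<Rightarrow> nat) \<Rightarrow> (nat \<Rightarrow> nat \<Rightarrow> nat) set" where
  "SSYT n mu = {T.
      (\<forall>r c. \<not> (1 \<le> r \<and> r \<le> n \<and> 1 \<le> c \<and> c \<le> mu r) \<longrightarrow> T r c = 0) \<and>
      (\<forall>r c. 1 \<le> r \<and> r \<le> n \<and> 1 \<le> c \<and> c \<le> mu r \<longrightarrow> 1 \<le> T r c \<and> T r c \<le> n) \<and>
      (\<forall>r c. 1 \<le> r \<and> r \<le> n \<and> 1 \<le> c \<and> Suc c \<le> mu r \<longrightarrow> T r c \<le> T r (Suc c)) \<and>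
      (\<forall>r c. 1 \<le> r \<and> Suc r \<le> n \<and> 1 \<le> c \<and> c \<le> mu (Suc r) \<longrightarrow> T r c < T (Suc r) c)}"

definition schur :: "nat \<Rightarrow> (nat \<Rightarrow> nat) \<Rightarrow> (nat \<Rightarrow> 'a::comm_ring_1) \<Rightarrow> 'a" where
  "schur n mu X = (\<Sum>T \<in> SSYT n mu.
      \<Prod>(r, c) \<in> {(r, c). 1 \<le> r \<and> r \<le> n \<and> 1 \<le> c \<and> c \<le> mu r}. X (T r c))"

text \<open>Extended Schur polynomial for lambda in Z^n (indices 1..n).  The sorting permutation
  sigma is unique; as the nonnegative shift p we take the least admissible one.\<close>
definition ext_schur :: "nat \<Rightarrow> (nat \<Rightarrow> int) \<Rightarrow> (nat \<Rightarrow> 'a::field) \<Rightarrow> 'a" where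
  "ext_schur n lam X =
    (if \<exists>i j. 1 \<le> i \<and> i < j \<and> j \<le> n \<and> lam i - int i = lam j - int j then 0
     else
       (let \<sigma> = (THE \<sigma>. \<sigma> permutes {1..n} \<and>
                  (\<forall>i j. 1 \<le> i \<and> i < j \<and> j \<le> n \<longrightarrow>
                      lam (\<sigma> i) - int (\<sigma> i) > lam (\<sigma> j) - int (\<sigma> j)));
            p = nat (- (lam (\<sigma> n) + int n - int (\<sigma> n)));
            mu = (\<lambda>i. nat (lam (\<sigma> i) + int i - int (\<sigma> i) + int p))
        in of_int (sign \<sigma>) * schur n mu X * (\<Prod>i = 1..n. X i powi (- int p))))"

definition pair_op :: "(arrow \<Rightarrow> 'a::field) \<Rightarrow> nat \<Rightarrow> nat \<Rightarrow> ((nat \<Rightarrow> int) \<Rightarrow> 'a) \<Rightarrow> (nat \<Rightarrow> int) \<Rightarrow> 'a" where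
  "pair_op \<omega> p q f k =
     \<omega> NE * f (k(p := k p + 1)) + \<omega> NW * f (k(q := k q - 1))
     + \<omega> NWNE * f ((k(p := k p + 1))(q := k q - 1)) + \<omega> Empty * f k"

definition index_pairs :: "nat \<Rightarrow> (nat \<times> nat) list" where
  "index_pairs n = concat (map (\<lambda>p. map (\<lambda>q. (p, q)) [Suc p..<Suc n]) [1..<Suc n])"

definition op_prod :: "nat \<Rightarrow> (arrow \<Rightarrow> 'a::field) \<Rightarrow> ((nat \<Rightarrow> int) \<Rightarrow> 'a) \<Rightarrow> (nat \<Rightarrow> int) \<Rightarrow> 'a" where
  "op_prod n \<omega> f = foldr (\<lambda>(p, q) g. pair_op \<omega> p q g) (index_pairs n) f"

end

(* For pairwise distinct X_i, write W(a, b) = w(NE) a + w(NW) / b + w(NWNE) a / b + w(Empty).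
   The operator product applied to the bialternant formula for s gives

     A_n(k) = sum_sigma sgn(sigma) prod_i X_sigma(i)^(k_i + i - 1) prod_{p<q} W(X_sigma(p), X_sigma(q)),

   divided by the Vandermonde product V_n. The generating function G_n satisfies the same recursion as
   (prod_i W(X_i, X_i)) A_n(k) / V_n: inserting the formula for n - 1 into the sum over the upper row, every
   signed interval yields a geometric sum, that is, a difference of two endpoint terms. Expand all these
   differences. If some position of the lower row receives endpoints from both neighbours, the term is
   symmetric in two variables and cancels. In each remaining term exactly one position m receives no
   endpoint; these terms form the expansion of A_n(k) by the position m of X_n, with the
   additional factor W(X_n, X_n). The weight w = (0, 0, 0, 1) gives the bialternant formula for s. *)
theory Submission
  imports Defs "HOL-Computational_Algebra.Formal_Laurent_Series"
begin

text \<open>The recursion closes because several shifts fit together. With x the variable of the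
  lower row, the sum over an entry l_j of the upper row is a geometric sum in Y_j / x, whose upper
  endpoint has exponent b + 1 rather than b. If position i + 1 receives both endpoints, this extra 1
  balances the staircase exponents i - 1 and i of Y_i and Y_(i+1): both variables get the same
  power, and only the order inside the W-factors remains to be symmetrized. W itself comes from the
  decorations: the eps of position i enters only the interval to its right and its delta only the
  interval to its left, so a decoration interacts only with the two endpoints that can meet at its
  position. Each such endpoint replaces one argument x of W(x, x) by a variable of the upper row,
  and an untouched position keeps W(x, x). N endpoints on N + 1 positions leave at least one
  position empty, and exactly one if none is hit twice. All divisions are by differences of
  variables. The field is arbitrary and may be finite, so distinct variables cannot be arranged
  inside it; this forces the passage to a larger field at the end.\<close>

section \<open>Signed sums over permutations and signed intervals\<close>

text \<open>Composition with the transposition matches the odd permutations with the even ones.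
  Deriving S = -S would not be enough in characteristic 2.\<close>

lemma sum_signed_permutes_eq_0:
  fixes F :: "('b \<Rightarrow> 'b) \<Rightarrow> 'a::comm_ring_1"
  assumes S: "finite S" "a \<in> S" "b \<in> S" "a \<noteq> b"
    and F: "\<And>\<sigma>. \<sigma> permutes S \<Longrightarrow> F (\<sigma> \<circ> transpose a b) = F \<sigma>"
  shows "(\<Sum>\<sigma> | \<sigma> permutes S. of_int (sign \<sigma>) * F \<sigma>) = 0"
proof -
  have t: "transpose a b permutes S"
    using S by (intro permutes_swap_id)
  have ev: "evenperm (\<sigma> \<circ> transpose a b) \<longleftrightarrow> \<not> evenperm \<sigma>" if "\<sigma> permutes S" for \<sigma>
    using that S t by (subst evenperm_comp) (auto simp: permutes_imp_permutation evenperm_swap)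
  have fin: "finite {\<sigma>. \<sigma> permutes S}"
    using S by (intro finite_permutations)
  have "(\<Sum>\<sigma> | \<sigma> permutes S \<and> \<not> evenperm \<sigma>. F \<sigma>) = (\<Sum>\<sigma> | \<sigma> permutes S \<and> evenperm \<sigma>. F \<sigma>)"
    by (rule sum.reindex_bij_witness[where i = "\<lambda>\<sigma>. \<sigma> \<circ> transpose a b" and j = "\<lambda>\<sigma>. \<sigma> \<circ> transpose a b"])
       (use t ev F in \<open>auto simp: permutes_compose comp_assoc\<close>)
  moreover have "(\<Sum>\<sigma> | \<sigma> permutes S. of_int (sign \<sigma>) * F \<sigma>) =
      (\<Sum>\<sigma> | \<sigma> permutes S \<and> evenperm \<sigma>. of_int (sign \<sigma>) * F \<sigma>) +
      (\<Sum>\<sigma> | \<sigma> permutes S \<and> \<not> evenperm \<sigma>. of_int (sign \<sigma>) * F \<sigma>)"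
    using fin by (subst sum.union_disjoint [symmetric]) (auto intro!: sum.cong)
  ultimately show ?thesis
    by (simp add: sign_def sum_negf)
qed

text \<open>As a word this is 1, ..., m - 1, n, m, ..., n - 1. Composing with it on the right
  inserts the value n at place m of the word of a permutation of {1..n - 1}.\<close>

definition insert_cycle :: "nat \<Rightarrow> nat \<Rightarrow> nat \<Rightarrow> nat" where
  "insert_cycle m n = (\<lambda>i. if i < m \<or> n < i then i else if i = m then n else i - 1)"

lemma insert_cycle_permutes_sign:
  assumes "1 \<le> m" "m \<le> n"
  shows "insert_cycle m n permutes {1..n} \<and> sign (insert_cycle m n) = (-1) ^ (n - m)"
  using assms(2,1)
proof (induction m rule: inc_induct)
  case base
  have "insert_cycle n n = id"
    by (auto simp: insert_cycle_def fun_eq_iff)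
  then show ?case by (simp add: permutes_id flip: id_def)
next
  case (step m)
  have eq: "insert_cycle m n = insert_cycle (Suc m) n \<circ> transpose m (Suc m)"
    using step.hyps step.prems by (auto simp: insert_cycle_def fun_eq_iff transpose_def)
  have t: "transpose m (Suc m) permutes {1..n}"
    using step.hyps step.prems by (intro permutes_swap_id) auto
  have "sign (insert_cycle m n) = - ((-1) ^ (n - Suc m))"
    unfolding eq using step.IH step.prems t
    by (subst sign_compose) (auto simp: sign_swap_id intro: permutes_imp_permutation[of "{1..n}"])
  also have "\<dots> = (-1) ^ (n - m)"
    using Suc_diff_Suc[OF step.hyps(2), symmetric] by simp
  finally show ?case
    using step.IH step.prems t by (metis eq le_SucI permutes_compose)
qed

text \<open>A permutation of {1..Suc N} is determined by the place m of the value Suc N and by the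
  word \<tau> that is left when this value is deleted. This is the combinatorial form of a Laplace
  expansion.\<close>

lemma sum_permutes_insert:
  fixes F :: "(nat \<Rightarrow> nat) \<Rightarrow> 'a::comm_ring_1"
  shows "(\<Sum>\<sigma> | \<sigma> permutes {1..Suc N}. of_int (sign \<sigma>) * F \<sigma>) =
    (\<Sum>m = 1..Suc N. \<Sum>\<tau> | \<tau> permutes {1..N}.
       of_int (sign \<tau>) * (-1) ^ (Suc N - m) * F (\<tau> \<circ> insert_cycle m (Suc N)))"
proof -
  let ?c = "\<lambda>m. insert_cycle m (Suc N)"
  have c: "?c m permutes {1..Suc N}" "sign (?c m) = (-1) ^ (Suc N - m)" if "m \<in> {1..Suc N}" for m
    using insert_cycle_permutes_sign[of m "Suc N"] that by auto
  have cm: "?c m m = Suc N" if "m \<in> {1..Suc N}" for m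
    using that by (auto simp: insert_cycle_def)
  have lift: "\<tau> permutes {1..Suc N}" if "\<tau> permutes {1..N}" for \<tau>
    using that by (rule permutes_subset) auto
  have 1: "inv \<sigma> (Suc N) \<in> {1..Suc N}" if "\<sigma> permutes {1..Suc N}" for \<sigma>
    using permutes_in_image[OF permutes_inv[OF that], of "Suc N"] by simp
  have "(\<Sum>m = 1..Suc N. \<Sum>\<tau> | \<tau> permutes {1..N}.
       of_int (sign \<tau>) * (-1) ^ (Suc N - m) * F (\<tau> \<circ> ?c m)) =
    (\<Sum>(m, \<tau>) \<in> {1..Suc N} \<times> {\<tau>. \<tau> permutes {1..N}}.
       of_int (sign \<tau>) * (-1) ^ (Suc N - m) * F (\<tau> \<circ> ?c m))"
    by (simp add: sum.cartesian_product)
  also have "\<dots> = (\<Sum>\<sigma> | \<sigma> permutes {1..Suc N}. of_int (sign \<sigma>) * F \<sigma>)"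
  proof (rule sum.reindex_bij_witness[where
        i = "\<lambda>\<sigma>. (inv \<sigma> (Suc N), \<sigma> \<circ> inv (?c (inv \<sigma> (Suc N))))" and
        j = "\<lambda>(m, \<tau>). \<tau> \<circ> ?c m"], goal_cases)
    case (1 x)
    then obtain m \<tau> where x: "x = (m, \<tau>)" "m \<in> {1..Suc N}" "\<tau> permutes {1..N}" by auto
    have \<tau>: "\<tau> permutes {1..Suc N}" "\<tau> (Suc N) = Suc N"
      using lift x by (auto intro: permutes_not_in)
    have p: "\<tau> \<circ> ?c m permutes {1..Suc N}"
      using \<tau> c x by (blast intro: permutes_compose)
    have "inv (\<tau> \<circ> ?c m) (Suc N) = m"
      using cm[OF x(2)] \<tau> by (subst permutes_inv_eq[OF p]) auto
    moreover have "\<tau> \<circ> ?c m \<circ> inv (?c m) = \<tau>"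
      using permutes_inv_o(1)[OF c(1)[OF x(2)]] by (simp add: comp_assoc)
    ultimately show ?case by (simp add: x)
  next
    case (2 x)
    then obtain m \<tau> where x: "x = (m, \<tau>)" "m \<in> {1..Suc N}" "\<tau> permutes {1..N}" by auto
    then show ?case using lift[OF x(3)] c[OF x(2)] by (auto intro: permutes_compose)
  next
    case (3 \<sigma>)
    then have "inv \<sigma> (Suc N) \<in> {1..Suc N}" using 1 by auto
    from permutes_inv_o(2)[OF c(1)[OF this]] show ?case by (simp add: comp_assoc)
  next
    case (4 \<sigma>)
    let ?m = "inv \<sigma> (Suc N)"
    have m: "?m \<in> {1..Suc N}" and \<sigma>: "\<sigma> permutes {1..Suc N}" using 1 4 by auto
    have p: "\<sigma> \<circ> inv (?c ?m) permutes {1..Suc N}"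
      using \<sigma> c[OF m] by (intro permutes_compose permutes_inv) auto
    have "inv (?c ?m) (Suc N) = ?m"
      using cm[OF m] by (subst permutes_inv_eq[OF c(1)[OF m]])
    then have fixN: "(\<sigma> \<circ> inv (?c ?m)) (Suc N) = Suc N"
      using permutes_inverses(1)[OF \<sigma>] by simp
    have "\<sigma> \<circ> inv (?c ?m) permutes {1..N}"
      by (rule permutes_superset[OF p]) (use fixN in \<open>auto simp: le_Suc_eq\<close>)
    then show ?case using m by auto
  next
    case (5 x)
    then obtain m \<tau> where x: "x = (m, \<tau>)" "m \<in> {1..Suc N}" "\<tau> permutes {1..N}" by auto
    have "sign (\<tau> \<circ> ?c m) = sign \<tau> * (-1) ^ (Suc N - m)"
      using x lift[OF x(3)] c[OF x(2)]
      by (subst sign_compose) (auto intro: permutes_imp_permutation[of "{1..Suc N}"])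
    then show ?case by (simp add: x)
  qed
  finally show ?thesis by simp
qed

text \<open>Distributivity for functions that take a default value z outside I, as rows (z = 0) and
  decorations (z = \<open>Empty\<close>) do, in place of the \<open>undefined\<close> of
  \<open>PiE\<close>.\<close>

lemma sum_prod_dflt:
  fixes f :: "'i \<Rightarrow> 'b \<Rightarrow> 'a::comm_semiring_1"
  assumes "finite I" "\<And>i. i \<in> I \<Longrightarrow> finite (B i)"
  shows "(\<Sum>g | (\<forall>i. i \<notin> I \<longrightarrow> g i = z) \<and> (\<forall>i\<in>I. g i \<in> B i). \<Prod>i\<in>I. f i (g i)) =
    (\<Prod>i\<in>I. \<Sum>x\<in>B i. f i x)"
proof -
  have "(\<Prod>i\<in>I. \<Sum>x\<in>B i. f i x) = (\<Sum>g\<in>PiE I B. \<Prod>i\<in>I. f i (g i))"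
    using assms by (rule prod_sum_PiE)
  also have "\<dots> = (\<Sum>g | (\<forall>i. i \<notin> I \<longrightarrow> g i = z) \<and> (\<forall>i\<in>I. g i \<in> B i). \<Prod>i\<in>I. f i (g i))"
    by (rule sum.reindex_bij_witness[where i = "\<lambda>g. restrict g I" and j = "\<lambda>g i. if i \<in> I then g i else z"])
       (auto simp: fun_eq_iff PiE_def extensional_def Pi_def restrict_def)
  finally show ?thesis ..
qed

section \<open>Geometric sums over signed intervals\<close>

definition sint_sign :: "int \<Rightarrow> int \<Rightarrow> 'a::ring_1" where
  "sint_sign a b = (if neg_sint a b then -1 else 1)"

lemma finite_sint: "finite {x. in_sint x a b}"
  by (rule finite_subset[of _ "{a..b} \<union> {b + 1..a - 1}"]) (auto simp: in_sint_def)

lemma geometric_sum_powi: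
  fixes z :: "'a::field"
  assumes "z \<noteq> 0" "a \<le> b"
  shows "(\<Sum>x\<in>{a..<b}. z powi x) * (z - 1) = z powi b - z powi a"
  using assms(2)
proof (induction b rule: int_ge_induct)
  case (step b)
  have "{a..<b + 1} = insert b {a..<b}" using step by auto
  then show ?case using step assms(1)
    by (simp add: algebra_simps power_int_add)
qed auto

text \<open>Reversing the limits of a telescoping sum changes its sign, and the signed interval
  encodes exactly this convention. Hence one endpoint formula serves all integers a and b, and no
  monotonicity of the rows has to be tracked.\<close>

lemma signed_geometric_sum:
  fixes z :: "'a::field"
  assumes "z \<noteq> 0" "z \<noteq> 1"
  shows "(\<Sum>x | in_sint x a b. sint_sign a b * z powi x) = (z powi (b + 1) - z powi a) / (z - 1)"
proof (cases "a \<le> b + 1")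
  case True
  then have "{x. in_sint x a b} = {a..<b + 1}" and "\<not> neg_sint a b"
    by (auto simp: in_sint_def neg_sint_def)
  then show ?thesis
    using geometric_sum_powi[of z a "b + 1"] assms True by (simp add: sint_sign_def field_simps)
next
  case False
  then have "{x. in_sint x a b} = {b + 1..<a}" and "neg_sint a b"
    by (auto simp: in_sint_def neg_sint_def)
  then show ?thesis
    using geometric_sum_powi[of z "b + 1" a] assms False
    by (simp add: sint_sign_def field_simps sum_negf)
qed

section \<open>Weighted alternants\<close>

definition index_pair_set :: "nat \<Rightarrow> (nat \<times> nat) set" where
  "index_pair_set n = {(p, q). 1 \<le> p \<and> p < q \<and> q \<le> n}"

text \<open>The W of the overview: the eigenvalue of the operator for the pair (p, q) on the
  function mapping k to a^(k_p) b^(k_q).\<close>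

definition arrow_factor :: "(arrow \<Rightarrow> 'a::field) \<Rightarrow> 'a \<Rightarrow> 'a \<Rightarrow> 'a" where
  "arrow_factor \<omega> a b = \<omega> NE * a + \<omega> NW * inverse b + \<omega> NWNE * (a * inverse b) + \<omega> Empty"

text \<open>For \<lambda> = (k_n, ..., k_1) the exponents \<lambda>_i + n - i, read backwards, are
  k_i + i - 1. They grow with the staircase i - 1, which fixes the orientation X q - X p in
  \<open>vandermonde\<close>.\<close>

definition alternant_term :: "nat \<Rightarrow> (arrow \<Rightarrow> 'a::field) \<Rightarrow> (nat \<Rightarrow> int) \<Rightarrow> (nat \<Rightarrow> 'a) \<Rightarrow> 'a" where
  "alternant_term n \<omega> k Y = (\<Prod>i = 1..n. Y i powi (k i + int i - 1)) *
     (\<Prod>(p, q) \<in> index_pair_set n. arrow_factor \<omega> (Y p) (Y q))"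

definition alternant :: "nat \<Rightarrow> (arrow \<Rightarrow> 'a::field) \<Rightarrow> (nat \<Rightarrow> 'a) \<Rightarrow> (nat \<Rightarrow> int) \<Rightarrow> 'a" where
  "alternant n \<omega> X k = (\<Sum>\<sigma> | \<sigma> permutes {1..n}. of_int (sign \<sigma>) * alternant_term n \<omega> k (X \<circ> \<sigma>))"

definition vandermonde :: "nat \<Rightarrow> (nat \<Rightarrow> 'a::field) \<Rightarrow> 'a" where
  "vandermonde n X = (\<Prod>(p, q) \<in> index_pair_set n. X q - X p)"

lemma finite_index_pair_set [simp]: "finite (index_pair_set n)"
  by (rule finite_subset[of _ "{1..n} \<times> {1..n}"]) (auto simp: index_pair_set_def)

lemma prod_index_pair_set_Suc:
  "prod f (index_pair_set (Suc N)) = prod f (index_pair_set N) * (\<Prod>p = 1..N. f (p, Suc N))"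
proof -
  have "index_pair_set (Suc N) = index_pair_set N \<union> (\<lambda>p. (p, Suc N)) ` {1..N}"
    by (auto simp: index_pair_set_def image_iff)
  moreover have "index_pair_set N \<inter> (\<lambda>p. (p, Suc N)) ` {1..N} = {}"
    by (auto simp: index_pair_set_def)
  ultimately show ?thesis
    by (simp add: prod.union_disjoint prod.reindex inj_on_def)
qed

lemma vandermonde_Suc: "vandermonde (Suc N) X = vandermonde N X * (\<Prod>j = 1..N. X (Suc N) - X j)"
  unfolding vandermonde_def by (simp add: prod_index_pair_set_Suc)

lemma prod_insert_cycle:
  assumes "m \<in> {1..Suc N}"
  shows "(\<Prod>i = 1..Suc N. f i) = f m * (\<Prod>j = 1..N. if j < m then f j else f (Suc j))"
proof -
  have "(\<Prod>i = 1..Suc N. f i) = f m * (\<Prod>i \<in> {1..Suc N} - {m}. f i)"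
    using assms by (subst prod.remove[of _ m]) auto
  also have "(\<Prod>i \<in> {1..Suc N} - {m}. f i) = (\<Prod>j = 1..N. if j < m then f j else f (Suc j))"
    by (rule prod.reindex_bij_witness[where j = "\<lambda>i. if i < m then i else i - 1"
          and i = "\<lambda>j. if j < m then j else Suc j"]) (use assms in auto)
  finally show ?thesis .
qed

text \<open>Z is Y with x inserted at place m. Pairs avoiding m correspond to the pairs of Y; the
  others pair x with each Y j, and the order of the arguments records the side on which Y j
  stands.\<close>

lemma prod_index_pair_set_insert_cycle:
  fixes f :: "'b \<Rightarrow> 'b \<Rightarrow> 'a::comm_monoid_mult"
  assumes m: "m \<in> {1..Suc N}"
    and Z: "\<And>i. i \<in> {1..Suc N} \<Longrightarrow> Z i = (if i < m then Y i else if i = m then x else Y (i - 1))"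
  shows "(\<Prod>(p, q) \<in> index_pair_set (Suc N). f (Z p) (Z q)) =
    (\<Prod>(p, q) \<in> index_pair_set N. f (Y p) (Y q)) *
    (\<Prod>j = 1..N. if j < m then f (Y j) x else f x (Y j))"
proof -
  let ?s = "\<lambda>j. if j < m then j else Suc j" and ?r = "\<lambda>i. if i < m then i else i - (1::nat)"
  let ?A = "{(p, q) \<in> index_pair_set (Suc N). p \<noteq> m \<and> q \<noteq> m}"
    and ?B = "{(p, q) \<in> index_pair_set (Suc N). p = m \<or> q = m}"
  have "(\<Prod>(p, q) \<in> index_pair_set (Suc N). f (Z p) (Z q)) =
      (\<Prod>(p, q) \<in> ?A. f (Z p) (Z q)) * (\<Prod>(p, q) \<in> ?B. f (Z p) (Z q))"
    by (subst prod.union_disjoint [symmetric])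
       (auto intro!: prod.cong finite_subset[OF _ finite_index_pair_set[of "Suc N"]])
  also have "(\<Prod>(p, q) \<in> ?A. f (Z p) (Z q)) = (\<Prod>(p, q) \<in> index_pair_set N. f (Y p) (Y q))"
    by (rule prod.reindex_bij_witness[where j = "\<lambda>(p, q). (?r p, ?r q)" and i = "\<lambda>(p, q). (?s p, ?s q)"])
       (use m in \<open>auto simp: index_pair_set_def Z split: if_splits\<close>)
  also have "(\<Prod>(p, q) \<in> ?B. f (Z p) (Z q)) = (\<Prod>j = 1..N. if j < m then f (Y j) x else f x (Y j))"
    by (rule prod.reindex_bij_witness[where j = "\<lambda>(p, q). if p = m then q - 1 else p"
          and i = "\<lambda>j. if j < m then (j, m) else (m, Suc j)"])
       (use m in \<open>auto simp: index_pair_set_def Z\<close>)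
  finally show ?thesis .
qed

text \<open>An adjacent swap reverses the order of the pair (i, i + 1) only, and the extra factor
  supplies the opposite order. No division is used, since an \<open>arrow_factor\<close> may be
  0.\<close>

lemma prod_index_pair_set_transpose:
  fixes f :: "'b \<Rightarrow> 'b \<Rightarrow> 'a::comm_monoid_mult"
  assumes i: "1 \<le> i" "Suc i \<le> N" and Z: "Z = Y \<circ> transpose i (Suc i)"
  shows "(\<Prod>(p, q) \<in> index_pair_set N. f (Z p) (Z q)) * f (Z (Suc i)) (Z i) =
    (\<Prod>(p, q) \<in> index_pair_set N. f (Y p) (Y q)) * f (Y (Suc i)) (Y i)"
proof -
  let ?t = "transpose i (Suc i)"
  let ?A = "index_pair_set N - {(i, Suc i)}"
  have mem: "(i, Suc i) \<in> index_pair_set N" using i by (auto simp: index_pair_set_def)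
  have "(\<Prod>(p, q) \<in> ?A. f (Z p) (Z q)) = (\<Prod>(p, q) \<in> ?A. f (Y p) (Y q))"
    by (rule prod.reindex_bij_witness[where j = "\<lambda>(p, q). (?t p, ?t q)" and i = "\<lambda>(p, q). (?t p, ?t q)"])
       (use i in \<open>auto simp: index_pair_set_def Z transpose_def split: if_splits\<close>)
  then show ?thesis
    using prod.remove[OF finite_index_pair_set mem, of "\<lambda>(p, q). f (Z p) (Z q)"]
      prod.remove[OF finite_index_pair_set mem, of "\<lambda>(p, q). f (Y p) (Y q)"]
    by (simp add: Z ac_simps)
qed

section \<open>The transfer of alternants from one row to the next\<close>

definition row_decs :: "nat \<Rightarrow> (nat \<Rightarrow> arrow) set" where
  "row_decs n = {d. \<forall>j. j \<notin> {1..n} \<longrightarrow> d j = Empty}"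

definition upper_rows :: "nat \<Rightarrow> (nat \<Rightarrow> int) \<Rightarrow> (nat \<Rightarrow> arrow) \<Rightarrow> (nat \<Rightarrow> int) set" where
  "upper_rows N k d = {l. (\<forall>j. j \<notin> {1..N} \<longrightarrow> l j = 0) \<and>
     (\<forall>j\<in>{1..N}. in_sint (l j) (k j + eps (d j)) (k (Suc j) - delta (d (Suc j))))}"

text \<open>The contribution of a lower row k with decoration d and variable x to the signed weight
  of a triangle whose next row upwards is l.\<close>

definition row_weight :: "nat \<Rightarrow> (arrow \<Rightarrow> 'a::field) \<Rightarrow> 'a \<Rightarrow> (nat \<Rightarrow> int) \<Rightarrow> (nat \<Rightarrow> arrow) \<Rightarrow> (nat \<Rightarrow> int) \<Rightarrow> 'a" where
  "row_weight N \<omega> x k d l =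
     (\<Prod>j = 1..N. sint_sign (k j + eps (d j)) (k (Suc j) - delta (d (Suc j)))) *
     (\<Prod>i = 1..Suc N. \<omega> (d i)) *
     x powi ((\<Sum>i = 1..Suc N. k i + eps (d i) - delta (d i)) - (\<Sum>j = 1..N. l j))"

lemma UNIV_arrow: "(UNIV :: arrow set) = {NE, NW, NWNE, Empty}"
  using arrow.exhaust by auto

lemma finite_arrow [simp]: "finite (A :: arrow set)"
proof -
  have "finite (UNIV :: arrow set)"
    unfolding UNIV_arrow by simp
  then show ?thesis
    by (rule rev_finite_subset) simp
qed

lemma finite_upper_rows: "finite (upper_rows N k d)"
proof -
  have "finite {f. \<forall>j. (j \<in> {1..N} \<longrightarrow> f j \<in> (\<Union>j\<in>{1..N}. {y. in_sint y (k j + eps (d j)) (k (Suc j) - delta (d (Suc j)))})) \<and> (j \<notin> {1..N} \<longrightarrow> f j = 0)}"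
    by (rule finite_set_of_finite_funs) (auto simp: finite_sint)
  then show ?thesis
    by (rule rev_finite_subset) (force simp: upper_rows_def)
qed

lemma powi_sum:
  fixes x :: "'a::field"
  assumes "x \<noteq> 0"
  shows "x powi (\<Sum>i\<in>A. f i) = (\<Prod>i\<in>A. x powi f i)"
  using assms by (induction A rule: infinite_finite_induct) (auto simp: power_int_add)

text \<open>After summing the geometric series, a set C of indices records for which j the sum over the
  entry j of the upper row contributes its upper endpoint (at position j + 1 of the lower row); the
  other j contribute the lower endpoint (at position j). The sum over the decorations then factors
  into one slot for each position i of the lower row, which is touched by the indices i - 1 and i.
  Index 0 never lies in C.\<close>
definition slot :: "nat \<Rightarrow> (arrow \<Rightarrow> 'a::field) \<Rightarrow> 'a \<Rightarrow> (nat \<Rightarrow> int) \<Rightarrow> nat set \<Rightarrow> (nat \<Rightarrow> 'a) \<Rightarrow> nat \<Rightarrow> 'a" where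
  "slot N \<omega> x k C Y i = x powi k i *
     (if i - 1 \<in> C then (Y (i - 1) / x) powi (k i + 1) else 1) *
     (if i \<le> N \<and> i \<notin> C then (Y i / x) powi k i else 1) *
     arrow_factor \<omega> (if i \<le> N \<and> i \<notin> C then Y i else x) (if i - 1 \<in> C then Y (i - 1) else x)"

text \<open>The factors are, in order: the denominators of the geometric sums, a sign for each lower
  endpoint, the staircase of the smaller alternant, and what remains at each position after summing
  over its decoration.\<close>

definition choice_term :: "nat \<Rightarrow> (arrow \<Rightarrow> 'a::field) \<Rightarrow> 'a \<Rightarrow> (nat \<Rightarrow> int) \<Rightarrow> nat set \<Rightarrow> (nat \<Rightarrow> 'a) \<Rightarrow> 'a" where
  "choice_term N \<omega> x k C Y = (\<Prod>j = 1..N. inverse (Y j / x - 1)) *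
     (\<Prod>j = 1..N. if j \<in> C then 1 else -1) *
     (\<Prod>j = 1..N. Y j powi (int j - 1)) * (\<Prod>i = 1..Suc N. slot N \<omega> x k C Y i)"

text \<open>The entry l_j occurs as x^(-l_j) from the row weight and as Y_j^(l_j) from the
  alternant, so the sum over it is a signed geometric sum in Y_j / x. The product over j of the
  resulting two-term differences expands into a sum over subsets C.\<close>

lemma row_transfer_aux:
  fixes x :: "'a::field"
  assumes x: "x \<noteq> 0" and Y: "\<And>j. j \<in> {1..N} \<Longrightarrow> Y j \<noteq> 0 \<and> Y j \<noteq> x"
  shows "(\<Sum>l\<in>upper_rows N k d. row_weight N \<omega> x k d l * (\<Prod>j = 1..N. Y j powi (l j + int j - 1))) =
    (\<Sum>C\<in>Pow {1..N}. (\<Prod>j = 1..N. inverse (Y j / x - 1)) *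
      (\<Prod>j = 1..N. if j \<in> C then 1 else -1) *
      (\<Prod>j = 1..N. Y j powi (int j - 1)) *
      (\<Prod>i = 1..Suc N. \<omega> (d i) * x powi (k i + eps (d i) - delta (d i)) *
        (if i - 1 \<in> C then (Y (i - 1) / x) powi (k i - delta (d i) + 1) else 1) *
        (if i \<le> N \<and> i \<notin> C then (Y i / x) powi (k i + eps (d i)) else 1)))" (is "?L = ?R")
proof -
  define z where "z j = Y j / x" for j
  have z: "z j \<noteq> 0" "z j \<noteq> 1" if "j \<in> {1..N}" for j
    using Y[OF that] x by (auto simp: z_def)
  define u v where "u j = k (Suc j) - delta (d (Suc j))" and "v j = k j + eps (d j)" for j
  define G where "G = (\<Prod>i = 1..Suc N. \<omega> (d i) * x powi (k i + eps (d i) - delta (d i)))"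
  define D where "D = (\<Prod>j = 1..N. inverse (z j - 1))"
  define V where "V = (\<Prod>j = 1..N. Y j powi (int j - 1))"
  have "?L = (\<Sum>l\<in>upper_rows N k d. G * V * (\<Prod>j = 1..N. sint_sign (v j) (u j) * z j powi l j))"
  proof (rule sum.cong[OF refl])
    fix l assume "l \<in> upper_rows N k d"
    have *: "Y j powi (l j + int j - 1) = Y j powi (int j - 1) * (x powi l j * z j powi l j)"
      if "j \<in> {1..N}" for j
    proof -
      have "Y j powi (l j + int j - 1) = Y j powi (int j - 1) * Y j powi (l j)"
        using Y[OF that] by (simp add: algebra_simps flip: power_int_add)
      also have "Y j powi (l j) = x powi l j * z j powi l j"
        using x by (simp add: z_def flip: power_int_mult_distrib)
      finally show ?thesis .
    qed
    have "(\<Prod>j = 1..N. Y j powi (l j + int j - 1)) =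
        V * ((\<Prod>j = 1..N. x powi l j) * (\<Prod>j = 1..N. z j powi l j))"
      unfolding V_def by (subst prod.distrib [symmetric])+ (intro prod.cong refl *, auto)
    moreover have "row_weight N \<omega> x k d l = (\<Prod>j = 1..N. sint_sign (v j) (u j)) * G / (\<Prod>j = 1..N. x powi l j)"
      unfolding row_weight_def G_def u_def v_def power_int_diff[OF disjI1[OF x], of "sum _ _"]
        powi_sum[OF x] prod.distrib by simp
    ultimately show "row_weight N \<omega> x k d l * (\<Prod>j = 1..N. Y j powi (l j + int j - 1)) =
        G * V * (\<Prod>j = 1..N. sint_sign (v j) (u j) * z j powi l j)"
      using x by (simp add: prod.distrib)
  qed
  also have "\<dots> = G * V * (\<Prod>j = 1..N. \<Sum>y | in_sint y (v j) (u j). sint_sign (v j) (u j) * z j powi y)"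
    using sum_prod_dflt[of "{1..N}" "\<lambda>j. {y. in_sint y (v j) (u j)}"
        "\<lambda>j y. sint_sign (v j) (u j) * z j powi y" 0]
    unfolding upper_rows_def u_def v_def sum_distrib_left [symmetric, of "G * V"]
    by (simp add: finite_sint)
  also have "(\<Prod>j = 1..N. \<Sum>y | in_sint y (v j) (u j). sint_sign (v j) (u j) * z j powi y) =
      (\<Prod>j = 1..N. inverse (z j - 1) * (z j powi (u j + 1) + (- (z j powi (v j)))))"
    proof (rule prod.cong[OF refl])
    fix j assume "j \<in> {1..N}"
    then show "(\<Sum>y | in_sint y (v j) (u j). sint_sign (v j) (u j) * z j powi y) =
        inverse (z j - 1) * (z j powi (u j + 1) + (- (z j powi (v j))))"
      using z by (subst signed_geometric_sum) (simp_all add: divide_inverse)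
  qed
  also have "\<dots> = D * (\<Sum>C\<in>Pow {1..N}. (\<Prod>j\<in>C. z j powi (u j + 1)) * (\<Prod>j\<in>{1..N} - C. - (z j powi (v j))))"
    unfolding prod.distrib D_def by (subst prod_add) auto
  also have "G * V * \<dots> = ?R"
    unfolding sum_distrib_left
  proof (rule sum.cong[OF refl])
    fix C assume "C \<in> Pow {1..N}"
    then have C: "C \<subseteq> {1..N}" by auto
    \<comment> \<open>The upper endpoint of index j sits at position Suc j, so the product is
      shifted by one. The new factor at i = 1 is 1 because 0 is not in C.\<close>
    have 1: "(\<Prod>j\<in>C. z j powi (u j + 1)) =
       (\<Prod>i = 1..Suc N. if i - 1 \<in> C then z (i - 1) powi (k i - delta (d i) + 1) else 1)"
    proof -
      have "(\<Prod>j\<in>C. z j powi (u j + 1)) = (\<Prod>j = 1..N. if j \<in> C then z j powi (u j + 1) else 1)"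
        using C by (intro prod.mono_neutral_cong_left) auto
      also have "\<dots> = (\<Prod>i = Suc 1..Suc N. if i - 1 \<in> C then z (i - 1) powi (k i - delta (d i) + 1) else 1)"
        by (subst prod.shift_bounds_cl_Suc_ivl) (auto simp: u_def cong: if_cong)
      also have "\<dots> = (\<Prod>i = 1..Suc N. if i - 1 \<in> C then z (i - 1) powi (k i - delta (d i) + 1) else 1)"
        by (rule prod.mono_neutral_left) (use C in \<open>auto simp: le_Suc_eq\<close>)
      finally show ?thesis .
    qed
    have 2: "(\<Prod>j\<in>{1..N} - C. - (z j powi (v j))) = (\<Prod>j = 1..N. if j \<in> C then 1 else -1) *
       (\<Prod>i = 1..Suc N. if i \<le> N \<and> i \<notin> C then z i powi (k i + eps (d i)) else 1)"
    proof -
      have "(\<Prod>j\<in>{1..N} - C. - (z j powi (v j))) = (\<Prod>j = 1..N. if j \<in> C then 1 else - (z j powi (v j)))"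
        by (intro prod.mono_neutral_cong_left) auto
      also have "\<dots> = (\<Prod>j = 1..N. (if j \<in> C then 1 else -1) * (if j \<in> C then 1 else z j powi (v j)))"
        by (intro prod.cong) auto
      also have "\<dots> = (\<Prod>j = 1..N. if j \<in> C then 1 else -1) * (\<Prod>j = 1..N. if j \<in> C then 1 else z j powi (v j))"
        by (rule prod.distrib)
      also have "(\<Prod>j = 1..N. (if j \<in> C then 1 else z j powi (v j))) =
          (\<Prod>i = 1..Suc N. if i \<le> N \<and> i \<notin> C then z i powi (k i + eps (d i)) else 1)"
        by (intro prod.mono_neutral_cong_left) (auto simp: v_def)
      finally show ?thesis .
    qed
    show "G * V * (D * ((\<Prod>j\<in>C. z j powi (u j + 1)) * (\<Prod>j\<in>{1..N} - C. - (z j powi (v j))))) =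
      (\<Prod>j = 1..N. inverse (Y j / x - 1)) *
      (\<Prod>j = 1..N. if j \<in> C then 1 else -1) *
      (\<Prod>j = 1..N. Y j powi (int j - 1)) *
      (\<Prod>i = 1..Suc N. \<omega> (d i) * x powi (k i + eps (d i) - delta (d i)) *
        (if i - 1 \<in> C then (Y (i - 1) / x) powi (k i - delta (d i) + 1) else 1) *
        (if i \<le> N \<and> i \<notin> C then (Y i / x) powi (k i + eps (d i)) else 1))"
      unfolding 1 2 G_def D_def V_def prod.distrib unfolding z_def
      by (simp only: ac_simps)
  qed
  finally show ?thesis .
qed

text \<open>At position i, \<open>eps\<close> contributes a factor x, which a lower endpoint of
  index i turns into Y i, and \<open>delta\<close> contributes 1 / x, which an upper endpoint of
  index i - 1 turns into 1 / Y (i - 1). Summing over the four arrows therefore gives an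
  \<open>arrow_factor\<close>.\<close>

lemma row_transfer:
  fixes x :: "'a::field"
  assumes x: "x \<noteq> 0" and Y: "\<And>j. j \<in> {1..N} \<Longrightarrow> Y j \<noteq> 0 \<and> Y j \<noteq> x"
  shows "(\<Sum>d\<in>row_decs (Suc N). \<Sum>l\<in>upper_rows N k d.
      row_weight N \<omega> x k d l * (\<Prod>j = 1..N. Y j powi (l j + int j - 1))) =
    (\<Sum>C\<in>Pow {1..N}. choice_term N \<omega> x k C Y)"
proof -
  define h where "h C i a = \<omega> a * x powi (k i + eps a - delta a) *
        (if i - 1 \<in> C then (Y (i - 1) / x) powi (k i - delta a + 1) else 1) *
        (if i \<le> N \<and> i \<notin> C then (Y i / x) powi (k i + eps a) else 1)" for C i a
  have "(\<Sum>d\<in>row_decs (Suc N). \<Sum>l\<in>upper_rows N k d.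
      row_weight N \<omega> x k d l * (\<Prod>j = 1..N. Y j powi (l j + int j - 1))) =
    (\<Sum>C\<in>Pow {1..N}. \<Sum>d\<in>row_decs (Suc N). (\<Prod>j = 1..N. inverse (Y j / x - 1)) *
      (\<Prod>j = 1..N. if j \<in> C then 1 else -1) *
      (\<Prod>j = 1..N. Y j powi (int j - 1)) * (\<Prod>i = 1..Suc N. h C i (d i)))"
    by (subst sum.swap) (simp only: row_transfer_aux[OF x Y] h_def)
  also have "\<dots> = (\<Sum>C\<in>Pow {1..N}. choice_term N \<omega> x k C Y)"
  proof (rule sum.cong[OF refl])
    fix C assume "C \<in> Pow {1..N}"
    then have C: "C \<subseteq> {1..N}" by auto
    have "(\<Sum>d\<in>row_decs (Suc N). (\<Prod>i = 1..Suc N. h C i (d i))) = (\<Prod>i = 1..Suc N. \<Sum>a\<in>UNIV. h C i a)"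
      unfolding row_decs_def by (subst sum_prod_dflt [symmetric, where z = Empty]) auto
    also have "\<dots> = (\<Prod>i = 1..Suc N. slot N \<omega> x k C Y i)"
    proof (rule prod.cong[OF refl])
      fix i assume "i \<in> {1..Suc N}"
      show "(\<Sum>a\<in>UNIV. h C i a) = slot N \<omega> x k C Y i"
      proof -
        have L: "Y (i - 1) \<noteq> 0" if "i - 1 \<in> C" using that C Y[of "i - 1"] by auto
        have R: "Y i \<noteq> 0" if "i \<le> N" using that Y[of i] \<open>i \<in> {1..Suc N}\<close> by auto
        show ?thesis
          unfolding UNIV_arrow using x L R
          by (auto simp: h_def slot_def arrow_factor_def eps_def delta_def power_int_add power_int_diff
              field_simps)
      qed
    qed
    finally show "(\<Sum>d\<in>row_decs (Suc N). (\<Prod>j = 1..N. inverse (Y j / x - 1)) *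
      (\<Prod>j = 1..N. if j \<in> C then 1 else -1) *
      (\<Prod>j = 1..N. Y j powi (int j - 1)) * (\<Prod>i = 1..Suc N. h C i (d i))) = choice_term N \<omega> x k C Y"
      unfolding choice_term_def by (simp flip: sum_distrib_left del: prod.cl_ivl_Suc)
  qed
  finally show ?thesis .
qed

text \<open>If position i + 1 of the lower row receives both endpoints, its slot carries the factor
  W(Y (i + 1), Y i), which complements the factor W(Y i, Y (i + 1)) of the product over pairs to a
  symmetric one. Hence the term cancels in the alternating sum.\<close>
lemma choice_term_transpose:
  fixes x :: "'a::field"
  assumes C: "C \<subseteq> {1..N}" and i: "i \<in> C" "Suc i \<notin> C" "Suc i \<le> N"
    and Z: "Z = Y \<circ> transpose i (Suc i)"
    and nz: "Y i \<noteq> 0" "Y (Suc i) \<noteq> 0" and x: "x \<noteq> 0"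
  shows "choice_term N \<omega> x k C Z * (\<Prod>(p, q) \<in> index_pair_set N. arrow_factor \<omega> (Z p) (Z q)) =
    choice_term N \<omega> x k C Y * (\<Prod>(p, q) \<in> index_pair_set N. arrow_factor \<omega> (Y p) (Y q))"
proof -
  have i1: "1 \<le> i" using C i by auto
  have Zi: "Z i = Y (Suc i)" "Z (Suc i) = Y i" "\<And>j. j \<noteq> i \<Longrightarrow> j \<noteq> Suc i \<Longrightarrow> Z j = Y j"
    using i by (auto simp: Z transpose_def)
  let ?P = "\<lambda>Y. \<Prod>(p, q) \<in> index_pair_set N. arrow_factor \<omega> (Y p) (Y q)"
  define D where "D Y = (\<Prod>j = 1..N. inverse (Y j / x - 1))" for Y :: "nat \<Rightarrow> 'a"
  define S :: 'a where "S = (\<Prod>j = 1..N. if j \<in> C then 1 else -1)"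
  have D: "D Z = D Y"
    unfolding D_def
    by (rule prod.reindex_bij_witness[where i = "transpose i (Suc i)" and j = "transpose i (Suc i)"])
       (use i i1 in \<open>auto simp: Z transpose_def\<close>)
  define V where "V Y = (\<Prod>j \<in> {1..N} - {i, Suc i}. Y j powi (int j - 1))" for Y :: "nat \<Rightarrow> 'a"
  have V: "(\<Prod>j = 1..N. Y j powi (int j - 1)) = Y i powi (int i - 1) * Y (Suc i) powi (int i) * V Y"
    for Y :: "nat \<Rightarrow> 'a"
    unfolding V_def using i i1
    by (subst prod.remove[of _ i], simp, simp, subst prod.remove[of _ "Suc i"])
       (auto simp: mult.assoc insert_commute Diff_insert2 [symmetric])
  have VZ: "V Z = V Y"
    unfolding V_def by (intro prod.cong) (auto simp: Zi)
  define T where "T Y = (\<Prod>j \<in> {1..Suc N} - {Suc i}. slot N \<omega> x k C Y j)" for Y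
  have T: "(\<Prod>j = 1..Suc N. slot N \<omega> x k C Y j) = slot N \<omega> x k C Y (Suc i) * T Y" for Y
    unfolding T_def using i by (subst prod.remove[of _ "Suc i"]) auto
  \<comment> \<open>No other slot sees the swapped variables: slot i would use Y i only for i
    outside C, and slot i + 2 would use Y (Suc i) only for Suc i in C.\<close>
  have TZ: "T Z = T Y"
    unfolding T_def
  proof (rule prod.cong[OF refl])
    fix j assume j: "j \<in> {1..Suc N} - {Suc i}"
    have "Z (j - 1) = Y (j - 1)" if "j - 1 \<in> C"
      using that j i by (intro Zi) auto
    moreover have "Z j = Y j" if "j \<notin> C"
      using that j i by (intro Zi) auto
    ultimately show "slot N \<omega> x k C Z j = slot N \<omega> x k C Y j"
      unfolding slot_def by (simp cong: if_cong)
  qed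
  have slot: "slot N \<omega> x k C Y (Suc i) = x powi k (Suc i) * (Y i / x) powi (k (Suc i) + 1) *
      (Y (Suc i) / x) powi k (Suc i) * arrow_factor \<omega> (Y (Suc i)) (Y i)" for Y
    using i by (simp add: slot_def)
  have "?P Z * arrow_factor \<omega> (Z (Suc i)) (Z i) = ?P Y * arrow_factor \<omega> (Y (Suc i)) (Y i)"
    using i i1 Z by (intro prod_index_pair_set_transpose)
  \<comment> \<open>Both variables carry the exponent k (Suc i) + i: the staircase gives i - 1 and
    i, the two endpoints give k (Suc i) + 1 and k (Suc i).\<close>
  moreover have "Z i powi (int i - 1) * Z (Suc i) powi (int i) * ((Z i / x) powi (k (Suc i) + 1) * (Z (Suc i) / x) powi k (Suc i)) =
     Y i powi (int i - 1) * Y (Suc i) powi (int i) * ((Y i / x) powi (k (Suc i) + 1) * (Y (Suc i) / x) powi k (Suc i))"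
    using nz x by (simp add: Zi power_int_add power_int_diff field_simps)
  ultimately have "(D Z * S * V Z * T Z * x powi k (Suc i)) *
     (Z i powi (int i - 1) * Z (Suc i) powi (int i) * ((Z i / x) powi (k (Suc i) + 1) * (Z (Suc i) / x) powi k (Suc i))) *
     (?P Z * arrow_factor \<omega> (Z (Suc i)) (Z i)) =
     (D Y * S * V Y * T Y * x powi k (Suc i)) *
     (Y i powi (int i - 1) * Y (Suc i) powi (int i) * ((Y i / x) powi (k (Suc i) + 1) * (Y (Suc i) / x) powi k (Suc i))) *
     (?P Y * arrow_factor \<omega> (Y (Suc i)) (Y i))"
    by (simp only: D VZ TZ)
  then show ?thesis
    unfolding choice_term_def V T slot D_def [symmetric] S_def [symmetric]
    by (simp only: ac_simps)
qed

text \<open>With C = {m..N}, position m is the only one that receives no endpoint. Its slot behaves as if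
  the last variable x had been inserted at place m.\<close>
lemma choice_term_final_segment:
  fixes x :: "'a::field"
  assumes m: "m \<in> {1..Suc N}" and x: "x \<noteq> 0" and Y: "\<And>j. j \<in> {1..N} \<Longrightarrow> Y j \<noteq> 0 \<and> Y j \<noteq> x"
    and Z: "\<And>i. i \<in> {1..Suc N} \<Longrightarrow> Z i = (if i < m then Y i else if i = m then x else Y (i - 1))"
  shows "choice_term N \<omega> x k {m..N} Y * (\<Prod>(p, q) \<in> index_pair_set N. arrow_factor \<omega> (Y p) (Y q)) *
      (\<Prod>j = 1..N. x - Y j) =
    arrow_factor \<omega> x x * ((-1) ^ (Suc N - m) * alternant_term (Suc N) \<omega> k Z)"
proof -
  let ?P = "\<Prod>(p, q) \<in> index_pair_set N. arrow_factor \<omega> (Y p) (Y q)"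
  let ?L = "\<lambda>j. if j < m then Y j powi (k j + int j - 1) * arrow_factor \<omega> (Y j) x
       else Y j powi (k (Suc j) + int j) * arrow_factor \<omega> x (Y j)"
  have Zm: "Z m = x" "\<And>j. j \<in> {1..N} \<Longrightarrow> j < m \<Longrightarrow> Z j = Y j"
      "\<And>j. j \<in> {1..N} \<Longrightarrow> \<not> j < m \<Longrightarrow> Z (Suc j) = Y j"
    using m by (auto simp: Z)
  have Zprod: "(\<Prod>i = 1..Suc N. Z i powi (k i + int i - 1)) = x powi (k m + int m - 1) *
      (\<Prod>j = 1..N. if j < m then Y j powi (k j + int j - 1) else Y j powi (k (Suc j) + int j))"
    unfolding prod_insert_cycle[OF m] Zm(1)
    by (intro arg_cong2[of _ _ _ _ "(*)"] prod.cong refl) (simp add: Zm)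
  have "alternant_term (Suc N) \<omega> k Z = (x powi (k m + int m - 1) *
      (\<Prod>j = 1..N. if j < m then Y j powi (k j + int j - 1) else Y j powi (k (Suc j) + int j))) *
      (?P * (\<Prod>j = 1..N. if j < m then arrow_factor \<omega> (Y j) x else arrow_factor \<omega> x (Y j)))"
    unfolding alternant_term_def Zprod
    by (subst prod_index_pair_set_insert_cycle[OF m Z]) auto
  also have "\<dots> = x powi (k m + int m - 1) * ?P * (\<Prod>j = 1..N. ?L j)"
  proof -
    have "(\<Prod>j = 1..N. ?L j) =
      (\<Prod>j = 1..N. if j < m then Y j powi (k j + int j - 1) else Y j powi (k (Suc j) + int j)) *
      (\<Prod>j = 1..N. if j < m then arrow_factor \<omega> (Y j) x else arrow_factor \<omega> x (Y j))"
      unfolding prod.distrib [symmetric] by (intro prod.cong) auto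
    then show ?thesis by (simp only: ac_simps)
  qed
  finally have A: "alternant_term (Suc N) \<omega> k Z = x powi (k m + int m - 1) * ?P * (\<Prod>j = 1..N. ?L j)" .
  \<comment> \<open>The position reached by index j: its own for a lower endpoint (j < m), the next
    one for an upper endpoint.\<close>
  let ?s = "\<lambda>j. if j < m then slot N \<omega> x k {m..N} Y j else slot N \<omega> x k {m..N} Y (Suc j)"
  have "choice_term N \<omega> x k {m..N} Y * (\<Prod>j = 1..N. x - Y j) =
     slot N \<omega> x k {m..N} Y m * (\<Prod>j = 1..N. inverse (Y j / x - 1) * (if j \<in> {m..N} then 1 else -1) *
       Y j powi (int j - 1) * ?s j * (x - Y j))"
    unfolding choice_term_def prod_insert_cycle[OF m, of "slot N \<omega> x k {m..N} Y"] prod.distrib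
    by (simp only: ac_simps)
  also have "\<dots> = slot N \<omega> x k {m..N} Y m * (\<Prod>j = 1..N. (if j < m then x else -1) * ?L j)"
  proof (rule arg_cong2[of _ _ _ _ "(*)", OF refl prod.cong[OF refl]])
    fix j assume j: "j \<in> {1..N}"
    note Yj = Y[OF j]
    show "inverse (Y j / x - 1) * (if j \<in> {m..N} then 1 else -1) * Y j powi (int j - 1) * ?s j * (x - Y j) =
       (if j < m then x else -1) * ?L j"
    proof (cases "j < m")
      case True
      then have "\<not> (j - 1 \<in> {m..N})" by auto
      then have "?s j = x powi k j * (Y j / x) powi k j * arrow_factor \<omega> (Y j) x"
        using True j by (simp add: slot_def)
      also have "x powi k j * (Y j / x) powi k j = Y j powi k j"
        using x by (simp flip: power_int_mult_distrib)
      finally have s: "?s j = Y j powi k j * arrow_factor \<omega> (Y j) x" .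
      have e: "Y j powi (k j + int j - 1) = Y j powi k j * Y j powi (int j - 1)"
        using Yj by (simp add: algebra_simps flip: power_int_add)
      have "inverse (Y j / x - 1) * (-1) * (x - Y j) = x"
        using Yj x by (simp add: field_simps)
      then have "(inverse (Y j / x - 1) * (-1) * (x - Y j)) * (Y j powi (int j - 1) * ?s j) = x * (Y j powi (int j - 1) * ?s j)"
        by simp
      then show ?thesis unfolding s e using True by (simp add: ac_simps)
    next
      case False
      then have "?s j = x powi k (Suc j) * (Y j / x) powi (k (Suc j) + 1) * arrow_factor \<omega> x (Y j)"
        using j by (simp add: slot_def)
      also have "x powi k (Suc j) * (Y j / x) powi (k (Suc j) + 1) = Y j powi k (Suc j) * (Y j / x)"
        using x Yj by (simp add: power_int_add power_int_divide_distrib)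
      finally have s: "?s j = Y j powi k (Suc j) * (Y j / x) * arrow_factor \<omega> x (Y j)" .
      have e: "Y j powi (k (Suc j) + int j) = Y j powi k (Suc j) * Y j * Y j powi (int j - 1)"
        using Yj by (simp add: power_int_add power_int_diff)
      have "inverse (Y j / x - 1) * (x - Y j) * (Y j / x) = - Y j"
        using Yj x by (simp add: field_simps)
      then have "(inverse (Y j / x - 1) * (x - Y j) * (Y j / x)) *
           (Y j powi (int j - 1) * (Y j powi k (Suc j) * arrow_factor \<omega> x (Y j))) =
           - Y j * (Y j powi (int j - 1) * (Y j powi k (Suc j) * arrow_factor \<omega> x (Y j)))"
        by simp
      then show ?thesis unfolding s e using False j by (simp add: ac_simps)
    qed
  qed
  also have "\<dots> = slot N \<omega> x k {m..N} Y m * (\<Prod>j = 1..N. if j < m then x else -1) * (\<Prod>j = 1..N. ?L j)"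
    by (simp add: prod.distrib)
  \<comment> \<open>The denominators have cancelled against the new Vandermonde factors x - Y j.
    What they leave is the staircase power of x at place m and the sign of the cycle that inserts it
    there.\<close>
  also have "(\<Prod>j = 1..N. if j < m then x else -1) = x ^ (m - 1) * (-1) ^ (Suc N - m)"
  proof -
    have "{1..N} \<inter> {j. j < m} = {1..m - 1}" "{1..N} \<inter> - {j. j < m} = {m..N}"
      using m by auto
    then show ?thesis by (subst prod.If_cases) simp_all
  qed
  also have "slot N \<omega> x k {m..N} Y m = x powi k m * arrow_factor \<omega> x x"
    using m by (simp add: slot_def) auto
  finally have B: "choice_term N \<omega> x k {m..N} Y * (\<Prod>j = 1..N. x - Y j) =
     x powi k m * arrow_factor \<omega> x x * (x ^ (m - 1) * (-1) ^ (Suc N - m)) * (\<Prod>j = 1..N. ?L j)" .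
  have e: "x powi (k m + int m - 1) = x powi k m * x ^ (m - 1)"
    using m x by (simp add: of_nat_diff algebra_simps flip: power_int_add power_int_of_nat)
  have "choice_term N \<omega> x k {m..N} Y * ?P * (\<Prod>j = 1..N. x - Y j) =
     (choice_term N \<omega> x k {m..N} Y * (\<Prod>j = 1..N. x - Y j)) * ?P"
    by (simp only: ac_simps)
  then show ?thesis unfolding A B e by (simp only: ac_simps)
qed

text \<open>The closure hypothesis says that no position receives endpoints from both sides. The
  empty set, where all indices choose the lower endpoint, is the case m = Suc N.\<close>

lemma final_segmentI:
  assumes "C \<subseteq> {1..N}" and "\<And>i. i \<in> C \<Longrightarrow> Suc i \<le> N \<Longrightarrow> Suc i \<in> C"
  shows "\<exists>m\<in>{1..Suc N}. C = {m..N}"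
proof (cases "C = {}")
  case True
  then show ?thesis by (intro bexI[of _ "Suc N"]) auto
next
  case False
  define m where "m = Min C"
  have fin: "finite C" using assms(1) finite_subset by blast
  have m: "m \<in> C" "\<And>j. j \<in> C \<Longrightarrow> m \<le> j"
    using False fin by (auto simp: m_def)
  have "j \<in> C" if "m \<le> j" "j \<le> N" for j
    using that by (induction j rule: dec_induct) (use m assms(2) in auto)
  then have "C = {m..N}" using m assms(1) by auto
  then show ?thesis using m(1) assms(1) by (intro bexI[of _ m]) auto
qed

text \<open>The recursion is used twice: with the given weight for the generating function, and with
  the trivial weight to derive the bialternant formula from tableaux.\<close>

lemma alternant_branching:
  fixes X :: "nat \<Rightarrow> 'a::field"
  assumes inj: "inj_on X {1..Suc N}" and nz: "\<And>i. i \<in> {1..Suc N} \<Longrightarrow> X i \<noteq> 0"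
  shows "(\<Sum>d\<in>row_decs (Suc N). \<Sum>l\<in>upper_rows N k d.
      row_weight N \<omega> (X (Suc N)) k d l * (alternant N \<omega> X l / vandermonde N X)) =
    arrow_factor \<omega> (X (Suc N)) (X (Suc N)) * (alternant (Suc N) \<omega> X k / vandermonde (Suc N) X)"
proof -
  define x where "x = X (Suc N)"
  define P where "P Y = (\<Prod>(p, q) \<in> index_pair_set N. arrow_factor \<omega> (Y p) (Y q))" for Y :: "nat \<Rightarrow> 'a"
  define R where "R = (\<Prod>j = 1..N. x - X j)"
  let ?S = "{\<sigma>. \<sigma> permutes {1..N}}"
  let ?c = "\<lambda>C \<sigma>. choice_term N \<omega> x k C (X \<circ> \<sigma>) * P (X \<circ> \<sigma>)"
  have x: "x \<noteq> 0" using nz by (auto simp: x_def)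
  have Y: "(X \<circ> \<sigma>) j \<noteq> 0 \<and> (X \<circ> \<sigma>) j \<noteq> x" if "\<sigma> \<in> ?S" "j \<in> {1..N}" for \<sigma> j
  proof -
    have "\<sigma> j \<in> {1..N}" using that permutes_in_image[of \<sigma> "{1..N}" j] by simp
    then show ?thesis using nz[of "\<sigma> j"] inj_onD[OF inj, of "\<sigma> j" "Suc N"] by (auto simp: x_def)
  qed
  have R: "R \<noteq> 0" using Y[of id] by (fastforce simp: R_def permutes_id)
  have R\<sigma>: "(\<Prod>j = 1..N. x - (X \<circ> \<sigma>) j) = R" if "\<sigma> \<in> ?S" for \<sigma>
    using prod.permute[of \<sigma> "{1..N}" "\<lambda>j. x - X j"] that by (simp add: R_def comp_def)
  have "(\<Sum>d\<in>row_decs (Suc N). \<Sum>l\<in>upper_rows N k d. row_weight N \<omega> x k d l * alternant N \<omega> X l) =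
      (\<Sum>d\<in>row_decs (Suc N). \<Sum>l\<in>upper_rows N k d. \<Sum>\<sigma>\<in>?S. of_int (sign \<sigma>) * P (X \<circ> \<sigma>) *
        (row_weight N \<omega> x k d l * (\<Prod>j = 1..N. (X \<circ> \<sigma>) j powi (l j + int j - 1))))"
    by (simp add: alternant_def alternant_term_def sum_distrib_left P_def ac_simps)
  also have "\<dots> = (\<Sum>\<sigma>\<in>?S. of_int (sign \<sigma>) * P (X \<circ> \<sigma>) * (\<Sum>d\<in>row_decs (Suc N). \<Sum>l\<in>upper_rows N k d.
        row_weight N \<omega> x k d l * (\<Prod>j = 1..N. (X \<circ> \<sigma>) j powi (l j + int j - 1))))"
    unfolding sum_distrib_left by (rule trans[OF sum.cong[OF refl sum.swap] sum.swap])
  also have "\<dots> = (\<Sum>\<sigma>\<in>?S. of_int (sign \<sigma>) * P (X \<circ> \<sigma>) * (\<Sum>C\<in>Pow {1..N}. choice_term N \<omega> x k C (X \<circ> \<sigma>)))"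
    by (intro sum.cong refl arg_cong2[of _ _ _ _ "(*)"] row_transfer x Y)
  also have "\<dots> = (\<Sum>C\<in>Pow {1..N}. \<Sum>\<sigma>\<in>?S. of_int (sign \<sigma>) * ?c C \<sigma>)"
    unfolding sum_distrib_left by (subst sum.swap) (simp only: ac_simps)
  \<comment> \<open>For any other C some i lies in C while Suc i <= N does not. The summand is then
    unchanged when places i and Suc i of the permutation are swapped, and its signed sum
    vanishes.\<close>
  also have "\<dots> = (\<Sum>C\<in>(\<lambda>m. {m..N}) ` {1..Suc N}. \<Sum>\<sigma>\<in>?S. of_int (sign \<sigma>) * ?c C \<sigma>)"
  proof (rule sum.mono_neutral_right; (intro ballI)?)
    fix C assume C: "C \<in> Pow {1..N} - (\<lambda>m. {m..N}) ` {1..Suc N}"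
    then obtain i where i: "i \<in> C" "Suc i \<le> N" "Suc i \<notin> C"
      using final_segmentI[of C N] by blast
    then have i': "i \<in> {1..N}" "Suc i \<in> {1..N}" using C by auto
    show "(\<Sum>\<sigma>\<in>?S. of_int (sign \<sigma>) * ?c C \<sigma>) = 0"
    proof (rule sum_signed_permutes_eq_0[of _ i "Suc i"])
      fix \<sigma> assume "\<sigma> permutes {1..N}"
      then show "?c C (\<sigma> \<circ> transpose i (Suc i)) = ?c C \<sigma>"
        unfolding P_def using C i Y[of \<sigma> i] Y[of \<sigma> "Suc i"] i' x
        by (intro choice_term_transpose) (auto simp: comp_assoc)
    qed (use i' in auto)
  qed auto
  also have "\<dots> = (\<Sum>m = 1..Suc N. \<Sum>\<sigma>\<in>?S. of_int (sign \<sigma>) * ?c {m..N} \<sigma>)"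
  proof (subst sum.reindex)
    show "inj_on (\<lambda>m. {m..N}) {1..Suc N}"
      by (auto simp: inj_on_def Icc_eq_Icc)
  qed (simp only: comp_def)
  finally have "(\<Sum>d\<in>row_decs (Suc N). \<Sum>l\<in>upper_rows N k d. row_weight N \<omega> x k d l * alternant N \<omega> X l) * R =
     (\<Sum>m = 1..Suc N. \<Sum>\<sigma>\<in>?S. of_int (sign \<sigma>) * ?c {m..N} \<sigma>) * R"
    by simp
  also have "\<dots> = (\<Sum>m = 1..Suc N. \<Sum>\<sigma>\<in>?S. of_int (sign \<sigma>) * (?c {m..N} \<sigma> * (\<Prod>j = 1..N. x - (X \<circ> \<sigma>) j)))"
    unfolding sum_distrib_right by (intro sum.cong refl) (simp add: R\<sigma>[simplified] mult.assoc)
  also have "\<dots> = (\<Sum>m = 1..Suc N. \<Sum>\<sigma>\<in>?S. of_int (sign \<sigma>) *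
      (arrow_factor \<omega> x x * ((-1) ^ (Suc N - m) * alternant_term (Suc N) \<omega> k (X \<circ> (\<sigma> \<circ> insert_cycle m (Suc N))))))"
  proof (rule sum.cong[OF refl], rule sum.cong[OF refl], rule arg_cong2[of _ _ _ _ "(*)", OF refl])
    fix m \<sigma> assume m: "m \<in> {1..Suc N}" and \<sigma>: "\<sigma> \<in> ?S"
    \<comment> \<open>So X \<circ> \<sigma> takes the value x at Suc N, the index to which
      \<open>insert_cycle\<close> sends m.\<close>
    have "\<sigma> (Suc N) = Suc N" using \<sigma> by (auto intro: permutes_not_in)
    then show "?c {m..N} \<sigma> * (\<Prod>j = 1..N. x - (X \<circ> \<sigma>) j) =
       arrow_factor \<omega> x x * ((-1) ^ (Suc N - m) * alternant_term (Suc N) \<omega> k (X \<circ> (\<sigma> \<circ> insert_cycle m (Suc N))))"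
      unfolding P_def using m \<sigma> x Y
      by (intro choice_term_final_segment) (auto simp: insert_cycle_def x_def)
  qed
  also have "\<dots> = arrow_factor \<omega> x x * alternant (Suc N) \<omega> X k"
    unfolding alternant_def sum_permutes_insert[of "\<lambda>\<sigma>. alternant_term (Suc N) \<omega> k (X \<circ> \<sigma>)"] sum_distrib_left
    by (simp only: ac_simps)
  finally have *: "(\<Sum>d\<in>row_decs (Suc N). \<Sum>l\<in>upper_rows N k d. row_weight N \<omega> x k d l * alternant N \<omega> X l) * R =
     arrow_factor \<omega> x x * alternant (Suc N) \<omega> X k" .
  have V: "vandermonde (Suc N) X = vandermonde N X * R"
    by (simp add: vandermonde_Suc R_def x_def)
  have "(\<Sum>d\<in>row_decs (Suc N). \<Sum>l\<in>upper_rows N k d. row_weight N \<omega> x k d l * (alternant N \<omega> X l / vandermonde N X)) =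
      (\<Sum>d\<in>row_decs (Suc N). \<Sum>l\<in>upper_rows N k d. row_weight N \<omega> x k d l * alternant N \<omega> X l) / vandermonde N X"
    by (simp add: sum_divide_distrib)
  also have "\<dots> = arrow_factor \<omega> x x * alternant (Suc N) \<omega> X k / vandermonde (Suc N) X"
    unfolding V * [symmetric] using R by simp
  finally show ?thesis by (simp add: x_def)
qed

section \<open>Removing the bottom row of a triangle\<close>

definition extend_triangle :: "nat \<Rightarrow> (nat \<Rightarrow> int) \<Rightarrow> (nat \<Rightarrow> arrow) \<Rightarrow>
    (nat \<Rightarrow> nat \<Rightarrow> int) \<times> (nat \<Rightarrow> nat \<Rightarrow> arrow) \<Rightarrow> (nat \<Rightarrow> nat \<Rightarrow> int) \<times> (nat \<Rightarrow> nat \<Rightarrow> arrow)" where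
  "extend_triangle N k d = (\<lambda>(a, e).
     (\<lambda>i j. if i = Suc N then if j \<in> {1..Suc N} then k j else 0 else a i j,
      \<lambda>i j. if i = Suc N then d j else e i j))"

abbreviation triangle_extensions where
  "triangle_extensions N k \<equiv> SIGMA d:row_decs (Suc N). SIGMA l:upper_rows N k d. ext_arrowed_MT N l"

lemma bij_betw_extend_triangle:
  "bij_betw (\<lambda>(d, l, t). extend_triangle N k d t) (triangle_extensions N k) (ext_arrowed_MT (Suc N) k)"
proof -
  \<comment> \<open>The inverse overwrites the removed row with the defaults that the encoding
    prescribes outside the triangle.\<close>
  define f' where "f' = (\<lambda>(a :: nat \<Rightarrow> nat \<Rightarrow> int, e :: nat \<Rightarrow> nat \<Rightarrow> arrow). (e (Suc N), a N,
      (\<lambda>i j. if i = Suc N then 0 else a i j, \<lambda>i j. if i = Suc N then Empty else e i j)))"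
  have 1: "f' (extend_triangle N k d (a, e)) = (d, l, (a, e)) \<and> extend_triangle N k d (a, e) \<in> ext_arrowed_MT (Suc N) k"
    if d: "d \<in> row_decs (Suc N)" and l: "l \<in> upper_rows N k d" and t: "(a, e) \<in> ext_arrowed_MT N l" for d l a e
  proof
    have out: "a i j = 0 \<and> e i j = Empty" if "(i, j) \<notin> cells N" for i j
      using t that by (auto simp: ext_arrowed_MT_def)
    have aN: "a N j = l j" for j
      using t l out[of N j] by (cases "j \<in> {1..N}") (auto simp: ext_arrowed_MT_def upper_rows_def cells_def)
    have S: "a (Suc N) j = 0 \<and> e (Suc N) j = Empty" for j
      using out by (auto simp: cells_def)
    show "f' (extend_triangle N k d (a, e)) = (d, l, (a, e))"
      using aN S by (auto simp: f'_def extend_triangle_def fun_eq_iff)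
    have "in_sint (a N j) (k j + eps (d j)) (k (Suc j) - delta (d (Suc j)))" if "1 \<le> j" "j \<le> N" for j
      using that l aN by (auto simp: upper_rows_def)
    moreover have "in_sint (a i j) (a (Suc i) j + eps (e (Suc i) j)) (a (Suc i) (Suc j) - delta (e (Suc i) (Suc j)))"
      if "1 \<le> j" "j \<le> i" "i < Suc N" "i \<noteq> N" for i j
      using that t by (auto simp: ext_arrowed_MT_def)
    ultimately show "extend_triangle N k d (a, e) \<in> ext_arrowed_MT (Suc N) k"
      using d out by (auto simp: extend_triangle_def ext_arrowed_MT_def cells_def row_decs_def)
  qed
  have 2: "(\<lambda>(d, l, t). extend_triangle N k d t) (f' (a, e)) = (a, e) \<and> f' (a, e) \<in> triangle_extensions N k"
    if t: "(a, e) \<in> ext_arrowed_MT (Suc N) k" for a e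
  proof
    have out: "a i j = 0 \<and> e i j = Empty" if "(i, j) \<notin> cells (Suc N)" for i j
      using t that by (auto simp: ext_arrowed_MT_def)
    have row: "a (Suc N) j = (if j \<in> {1..Suc N} then k j else 0)" for j
      using t out[of "Suc N" j] by (auto simp: ext_arrowed_MT_def cells_def)
    have int: "in_sint (a i j) (a (Suc i) j + eps (e (Suc i) j)) (a (Suc i) (Suc j) - delta (e (Suc i) (Suc j)))"
      if "1 \<le> j" "j \<le> i" "i < Suc N" for i j
      using t that by (auto simp: ext_arrowed_MT_def)
    show "(\<lambda>(d, l, t). extend_triangle N k d t) (f' (a, e)) = (a, e)"
      using row by (auto simp: f'_def extend_triangle_def fun_eq_iff)
    have "e (Suc N) \<in> row_decs (Suc N)"
      using out by (auto simp: row_decs_def cells_def)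
    moreover have "a N \<in> upper_rows N k (e (Suc N))"
      using out[of N] int[of _ N] row by (auto simp: upper_rows_def cells_def)
    moreover have "(\<lambda>i j. if i = Suc N then 0 else a i j, \<lambda>i j. if i = Suc N then Empty else e i j) \<in> ext_arrowed_MT N (a N)"
      using out int by (auto simp: ext_arrowed_MT_def cells_def)
    ultimately show "f' (a, e) \<in> triangle_extensions N k"
      by (auto simp: f'_def)
  qed
  show ?thesis
    by (rule bij_betw_byWitness[where f' = f']) (use 1 2 in \<open>fastforce+\<close>)
qed

lemma ext_arrowed_MT_0: "ext_arrowed_MT 0 k = {(\<lambda>i j. 0, \<lambda>i j. Empty)}"
  by (auto simp: ext_arrowed_MT_def cells_def fun_eq_iff)

lemma finite_row_decs: "finite (row_decs n)"
proof -
  have "finite {f. \<forall>j. (j \<in> {1..n} \<longrightarrow> f j \<in> (UNIV :: arrow set)) \<and> (j \<notin> {1..n} \<longrightarrow> f j = Empty)}"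
    by (rule finite_set_of_finite_funs) auto
  then show ?thesis by (simp add: row_decs_def)
qed

lemma finite_ext_arrowed_MT: "finite (ext_arrowed_MT n k)"
proof (induction n arbitrary: k)
  case 0
  then show ?case by (simp add: ext_arrowed_MT_0)
next
  case (Suc n)
  have "finite (triangle_extensions n k)"
    by (intro finite_SigmaI finite_row_decs finite_upper_rows Suc)
  then show ?case using bij_betw_finite[OF bij_betw_extend_triangle] by blast
qed

lemma minus_one_power_card:
  "finite A \<Longrightarrow> (- 1 :: 'a::comm_ring_1) ^ card {x\<in>A. P x} = (\<Prod>x\<in>A. if P x then -1 else 1)"
  by (simp add: prod.If_cases Int_def)

text \<open>An arrow \<open>NWNE\<close> counts in both \<open>eps\<close> and \<open>delta\<close>
  and cancels, as the weight requires.\<close>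

lemma count_arrow_diff: "count_arrow d i NE - count_arrow d i NW = (\<Sum>j = 1..i. eps (d i j) - delta (d i j))"
proof -
  have "count_arrow d i e = (\<Sum>j = 1..i. if d i j = e then 1 else 0)" for e
    by (simp add: count_arrow_def sum.If_cases Int_def conj_assoc)
  then show ?thesis
    by (auto simp: eps_def delta_def sum_subtractf [symmetric] intro!: sum.cong)
qed

text \<open>Sign and weight are products over rows, and the exponent of X i involves only rows i and
  i - 1. Thus adding a row multiplies by a factor that depends on the triangle only through its
  bottom row l.\<close>

lemma extend_triangle_weight:
  fixes X :: "nat \<Rightarrow> 'a::field"
  assumes l: "l \<in> upper_rows N k d" and t: "(a, e) \<in> ext_arrowed_MT N l"
    and ext: "extend_triangle N k d (a, e) = (a', e')"
  shows "(- 1) ^ neg_count (Suc N) a' e' * tri_weight (Suc N) \<omega> X a' e' =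
    row_weight N \<omega> (X (Suc N)) k d l * ((- 1) ^ neg_count N a e * tri_weight N \<omega> X a e)"
proof -
  have a': "a' i j = a i j" "e' i j = e i j" if "i \<noteq> Suc N" for i j
    using ext that by (auto simp: extend_triangle_def)
  have aS: "a' (Suc N) j = k j" if "j \<in> {1..Suc N}" for j
    using ext that by (auto simp: extend_triangle_def)
  have aS': "a' (Suc N) (Suc j) = k (Suc j)" if "j < Suc N" for j
    using aS[of "Suc j"] that by simp
  have eS: "e' (Suc N) j = d j" for j
    using ext by (auto simp: extend_triangle_def)
  have aN: "a N j = l j" if "j \<in> {1..N}" for j
    using t that by (auto simp: ext_arrowed_MT_def)
  let ?neg = "{j \<in> {1..N}. neg_sint (k j + eps (d j)) (k (Suc j) - delta (d (Suc j)))}"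
  let ?A = "{(i, j). 2 \<le> i \<and> i \<le> N \<and> 1 \<le> j \<and> j < i \<and> neg_sint (a i j + eps (e i j)) (a i (Suc j) - delta (e i (Suc j)))}"
  have fin: "finite ?A"
    by (rule finite_subset[of _ "{1..N} \<times> {1..N}"]) auto
  have "neg_count (Suc N) a' e' = card (?A \<union> Pair (Suc N) ` ?neg)"
    unfolding neg_count_def by (rule arg_cong[of _ _ card]) (auto simp: a' aS aS' eS le_Suc_eq image_iff)
  also have "\<dots> = neg_count N a e + card ?neg"
    unfolding neg_count_def
    using fin by (subst card_Un_disjoint) (auto simp: card_image inj_on_def)
  finally have 1: "(- 1 :: 'a) ^ neg_count (Suc N) a' e' = (- 1) ^ neg_count N a e *
      (\<Prod>j = 1..N. sint_sign (k j + eps (d j)) (k (Suc j) - delta (d (Suc j))))"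
    by (simp add: power_add sint_sign_def flip: minus_one_power_card)
  have "cells (Suc N) = cells N \<union> Pair (Suc N) ` {1..Suc N}" "cells N \<inter> Pair (Suc N) ` {1..Suc N} = {}"
    by (auto simp: cells_def le_Suc_eq)
  moreover have "finite (cells N)"
    by (rule finite_subset[of _ "{1..N} \<times> {1..N}"]) (auto simp: cells_def)
  ultimately have "(\<Prod>(i, j) \<in> cells (Suc N). \<omega> (e' i j)) =
      (\<Prod>(i, j) \<in> cells N. \<omega> (e' i j)) * (\<Prod>j = 1..Suc N. \<omega> (e' (Suc N) j))"
    by (simp add: prod.union_disjoint prod.reindex inj_on_def del: prod.cl_ivl_Suc)
  also have "(\<Prod>(i, j) \<in> cells N. \<omega> (e' i j)) = (\<Prod>(i, j) \<in> cells N. \<omega> (e i j))"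
    by (rule prod.cong) (auto simp: cells_def a')
  finally have 2: "(\<Prod>(i, j) \<in> cells (Suc N). \<omega> (e' i j)) =
      (\<Prod>(i, j) \<in> cells N. \<omega> (e i j)) * (\<Prod>j = 1..Suc N. \<omega> (d j))"
    by (simp only: eS)
  have rs: "row_sum a' i = row_sum a i" "count_arrow e' i x = count_arrow e i x" if "i \<le> N" for i x
    using that by (auto simp: row_sum_def count_arrow_def a')
  have "row_sum a' (Suc N) = (\<Sum>i = 1..Suc N. k i)"
    unfolding row_sum_def by (intro sum.cong refl aS)
  moreover have "row_sum a' N = (\<Sum>j = 1..N. l j)"
    by (simp add: rs) (simp add: row_sum_def aN)
  ultimately have 3: "row_sum a' (Suc N) - row_sum a' N + count_arrow e' (Suc N) NE - count_arrow e' (Suc N) NW =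
      (\<Sum>i = 1..Suc N. k i + eps (d i) - delta (d i)) - (\<Sum>j = 1..N. l j)"
    using count_arrow_diff[of e' "Suc N"] by (simp add: eS sum.distrib sum_subtractf del: sum.cl_ivl_Suc)
  have 4: "(\<Prod>i = 1..N. X i powi (row_sum a' i - row_sum a' (i - 1) + count_arrow e' i NE - count_arrow e' i NW)) =
     (\<Prod>i = 1..N. X i powi (row_sum a i - row_sum a (i - 1) + count_arrow e i NE - count_arrow e i NW))"
  proof (rule prod.cong[OF refl])
    fix i assume "i \<in> {1..N}"
    then have "i \<le> N" "i - 1 \<le> N" by auto
    then show "X i powi (row_sum a' i - row_sum a' (i - 1) + count_arrow e' i NE - count_arrow e' i NW) =
        X i powi (row_sum a i - row_sum a (i - 1) + count_arrow e i NE - count_arrow e i NW)"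
      by (simp only: rs)
  qed
  show ?thesis
    unfolding tri_weight_def row_weight_def 1 2 prod.cl_ivl_Suc[of _ 1 N] 4
    by (simp add: 3 del: prod.cl_ivl_Suc sum.cl_ivl_Suc)
qed

lemma gen_fun_Suc:
  fixes X :: "nat \<Rightarrow> 'a::field"
  shows "gen_fun (Suc N) \<omega> X k = (\<Sum>d\<in>row_decs (Suc N). \<Sum>l\<in>upper_rows N k d.
      row_weight N \<omega> (X (Suc N)) k d l * gen_fun N \<omega> X l)"
proof -
  let ?w = "\<lambda>N (a, e). (- 1) ^ neg_count N a e * tri_weight N \<omega> X a e"
  have "gen_fun (Suc N) \<omega> X k = (\<Sum>(d, l, t)\<in>triangle_extensions N k. ?w (Suc N) (extend_triangle N k d t))"
    unfolding gen_fun_def using sum.reindex_bij_betw[OF bij_betw_extend_triangle, of "?w (Suc N)" N k]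
    by (simp add: case_prod_unfold)
  also have "\<dots> = (\<Sum>(d, l, t)\<in>triangle_extensions N k. row_weight N \<omega> (X (Suc N)) k d l * ?w N t)"
    using extend_triangle_weight by (intro sum.cong refl) (auto split: prod.splits)
  also have "\<dots> = (\<Sum>d\<in>row_decs (Suc N). \<Sum>l\<in>upper_rows N k d. \<Sum>t\<in>ext_arrowed_MT N l.
      row_weight N \<omega> (X (Suc N)) k d l * ?w N t)"
    by (simp add: sum.Sigma finite_row_decs finite_upper_rows finite_ext_arrowed_MT)
  finally show ?thesis
    by (simp add: gen_fun_def sum_distrib_left)
qed

lemma gen_fun_alternant:
  fixes X :: "nat \<Rightarrow> 'a::field"
  assumes "inj_on X {1..n}" "\<And>i. i \<in> {1..n} \<Longrightarrow> X i \<noteq> 0"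
  shows "gen_fun n \<omega> X k =
    (\<Prod>i = 1..n. arrow_factor \<omega> (X i) (X i)) * (alternant n \<omega> X k / vandermonde n X)"
  using assms
proof (induction n arbitrary: k)
  case 0
  have "index_pair_set 0 = {}" "cells 0 = {}" by (auto simp: index_pair_set_def cells_def)
  moreover have "neg_count 0 a e = 0" for a e
    by (auto simp: neg_count_def intro!: card_eq_0_iff[THEN iffD2])
  ultimately show ?case
    by (simp add: gen_fun_def ext_arrowed_MT_0 tri_weight_def alternant_def vandermonde_def alternant_term_def)
next
  case (Suc n)
  have IH: "gen_fun n \<omega> X l = (\<Prod>i = 1..n. arrow_factor \<omega> (X i) (X i)) * (alternant n \<omega> X l / vandermonde n X)" for l
    using Suc.prems by (intro Suc.IH) (auto intro: inj_on_subset)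
  have "gen_fun (Suc n) \<omega> X k = (\<Prod>i = 1..n. arrow_factor \<omega> (X i) (X i)) *
     (\<Sum>d\<in>row_decs (Suc n). \<Sum>l\<in>upper_rows n k d.
      row_weight n \<omega> (X (Suc n)) k d l * (alternant n \<omega> X l / vandermonde n X))"
    unfolding gen_fun_Suc IH sum_distrib_left by (simp only: ac_simps)
  also have "(\<Sum>d\<in>row_decs (Suc n). \<Sum>l\<in>upper_rows n k d.
      row_weight n \<omega> (X (Suc n)) k d l * (alternant n \<omega> X l / vandermonde n X)) =
      arrow_factor \<omega> (X (Suc n)) (X (Suc n)) * (alternant (Suc n) \<omega> X k / vandermonde (Suc n) X)"
    by (rule alternant_branching[OF Suc.prems])
  finally show ?case by simp
qed

section \<open>The operator product on alternants\<close>

text \<open>Shifts act diagonally on exponential functions: E_{k_p} multiplies by Y p and the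
  inverse of E_{k_q} divides by Y q. As p and q differ, the two shifts act independently.\<close>

lemma pair_op_exponential_sum:
  fixes X :: "nat \<Rightarrow> 'a::field"
  assumes nz: "\<And>\<sigma> i. \<sigma> \<in> S \<Longrightarrow> i \<in> {1..n} \<Longrightarrow> Y \<sigma> i \<noteq> (0 :: 'a)"
    and pq: "p \<in> {1..n}" "q \<in> {1..n}" "p \<noteq> q"
  shows "pair_op \<omega> p q (\<lambda>k. \<Sum>\<sigma>\<in>S. c \<sigma> * (\<Prod>i = 1..n. Y \<sigma> i powi (k i + int i - 1))) =
    (\<lambda>k. \<Sum>\<sigma>\<in>S. (c \<sigma> * arrow_factor \<omega> (Y \<sigma> p) (Y \<sigma> q)) * (\<Prod>i = 1..n. Y \<sigma> i powi (k i + int i - 1)))"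
proof
  fix k
  let ?g = "\<lambda>\<sigma> k. \<Prod>i = 1..n. Y \<sigma> i powi (k i + int i - 1)"
  have upd: "?g \<sigma> (k(r := k r + s)) = Y \<sigma> r powi s * ?g \<sigma> k" if "\<sigma> \<in> S" "r \<in> {1..n}" for \<sigma> r s k
  proof -
    have "?g \<sigma> (k(r := k r + s)) = Y \<sigma> r powi (k r + s + int r - 1) * (\<Prod>i \<in> {1..n} - {r}. Y \<sigma> i powi (k i + int i - 1))"
      using that by (subst prod.remove[of _ r]) (auto intro!: prod.cong)
    also have "Y \<sigma> r powi (k r + s + int r - 1) = Y \<sigma> r powi s * Y \<sigma> r powi (k r + int r - 1)"
      using nz[OF that] by (simp add: algebra_simps flip: power_int_add)
    finally show ?thesis
      using that by (subst (2) prod.remove[of _ r]) (auto simp: mult.assoc)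
  qed
  have p: "?g \<sigma> (k(p := k p + 1)) = Y \<sigma> p * ?g \<sigma> k" if "\<sigma> \<in> S" for \<sigma> k
    using upd[OF that pq(1), of k 1] by simp
  have q: "?g \<sigma> (k(q := k q - 1)) = inverse (Y \<sigma> q) * ?g \<sigma> k" if "\<sigma> \<in> S" for \<sigma> k
    using upd[OF that pq(2), of k "-1"] by (simp add: power_int_minus)
  have pq': "?g \<sigma> ((k(p := k p + 1))(q := k q - 1)) = inverse (Y \<sigma> q) * (Y \<sigma> p * ?g \<sigma> k)" if "\<sigma> \<in> S" for \<sigma>
    using q[OF that, of "k(p := k p + 1)"] pq p[OF that, of k] by simp
  show "pair_op \<omega> p q (\<lambda>k. \<Sum>\<sigma>\<in>S. c \<sigma> * ?g \<sigma> k) k =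
     (\<Sum>\<sigma>\<in>S. (c \<sigma> * arrow_factor \<omega> (Y \<sigma> p) (Y \<sigma> q)) * ?g \<sigma> k)"
    unfolding pair_op_def sum_distrib_left sum.distrib [symmetric]
    by (rule sum.cong[OF refl], simp only: p q pq') (simp add: arrow_factor_def algebra_simps)
qed

lemma set_index_pairs: "set (index_pairs n) = index_pair_set n"
  by (fastforce simp: index_pairs_def index_pair_set_def image_iff simp del: upt_Suc)

lemma distinct_index_pairs: "distinct (index_pairs n)"
proof -
  have "distinct (concat (map (\<lambda>p. map (Pair p) [Suc p..<Suc n]) ps))" if "distinct ps" for ps
    using that by (induction ps) (auto simp: distinct_map inj_on_def simp del: upt_Suc)
  then show ?thesis by (simp add: index_pairs_def del: upt_Suc)
qed

text \<open>With this weight all factors of the operator product are 1, and extended arrowed monotone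
  triangles become signed Gelfand-Tsetlin patterns.\<close>
definition trivial_weight :: "arrow \<Rightarrow> 'a::field" where
  "trivial_weight a = (if a = Empty then 1 else 0)"

lemma arrow_factor_trivial [simp]: "arrow_factor trivial_weight a b = 1"
  by (simp add: arrow_factor_def trivial_weight_def)

text \<open>The denominator does not depend on k, and every pair operator multiplies each
  exponential by its \<open>arrow_factor\<close>. The whole product turns the plain alternant into
  the weighted one, whatever the order of the pairs.\<close>

lemma op_prod_alternant:
  fixes X :: "nat \<Rightarrow> 'a::field"
  assumes nz: "\<And>i. i \<in> {1..n} \<Longrightarrow> X i \<noteq> 0"
  shows "op_prod n \<omega> (\<lambda>k. alternant n trivial_weight X k / v) k = alternant n \<omega> X k / v"
proof -
  let ?S = "{\<sigma>. \<sigma> permutes {1..n}}"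
  define Y :: "(nat \<Rightarrow> nat) \<Rightarrow> nat \<Rightarrow> 'a" where "Y \<sigma> = X \<circ> \<sigma>" for \<sigma>
  let ?g = "\<lambda>\<sigma> k. \<Prod>i = 1..n. Y \<sigma> i powi (k i + int i - 1)"
  have nz': "Y \<sigma> i \<noteq> 0" if "\<sigma> \<in> ?S" "i \<in> {1..n}" for \<sigma> i
    using nz[of "\<sigma> i"] that permutes_in_image[of \<sigma> "{1..n}" i] by (simp add: Y_def)
  have "foldr (\<lambda>(p, q) g. pair_op \<omega> p q g) ps (\<lambda>k. \<Sum>\<sigma>\<in>?S. c \<sigma> * ?g \<sigma> k) =
     (\<lambda>k. \<Sum>\<sigma>\<in>?S. (c \<sigma> * prod_list (map (\<lambda>(p, q). arrow_factor \<omega> (Y \<sigma> p) (Y \<sigma> q)) ps)) * ?g \<sigma> k)"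
    if "set ps \<subseteq> index_pair_set n" for ps c
    using that
  proof (induction ps)
    case (Cons pq ps)
    obtain p q where pq: "pq = (p, q)" by fastforce
    have "p \<in> {1..n}" "q \<in> {1..n}" "p \<noteq> q" using Cons.prems by (auto simp: pq index_pair_set_def)
    note step = pair_op_exponential_sum[where Y = Y and S = ?S, OF nz' this]
    have "set ps \<subseteq> index_pair_set n" using Cons.prems by simp
    then show ?case
      by (simp only: pq foldr.simps o_apply prod.case Cons.IH step list.map prod_list.Cons) (simp only: ac_simps)
  qed auto
  from this[of "index_pairs n" "\<lambda>\<sigma>. of_int (sign \<sigma>) / v"]
  show ?thesis
    by (simp add: op_prod_def alternant_def alternant_term_def Y_def set_index_pairs sum_divide_distrib
        distinct_index_pairs prod.distinct_set_conv_list [symmetric] ac_simps)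
qed

section \<open>Schur polynomials as quotients of alternants\<close>

text \<open>The shapes \<nu> inside mu for which mu / \<nu> is a horizontal strip containing the
  whole of row N + 1.\<close>

definition interlacing_below :: "nat \<Rightarrow> (nat \<Rightarrow> nat) \<Rightarrow> (nat \<Rightarrow> nat) set" where
  "interlacing_below N mu = {\<nu>. (\<forall>i. i \<notin> {1..N} \<longrightarrow> \<nu> i = 0) \<and> (\<forall>i\<in>{1..N}. mu (Suc i) \<le> \<nu> i \<and> \<nu> i \<le> mu i)}"

definition extend_tableau :: "nat \<Rightarrow> (nat \<Rightarrow> nat) \<Rightarrow> (nat \<Rightarrow> nat) \<Rightarrow> (nat \<Rightarrow> nat \<Rightarrow> nat) \<Rightarrow> nat \<Rightarrow> nat \<Rightarrow> nat" where
  "extend_tableau N mu \<nu> T = (\<lambda>r c. if 1 \<le> r \<and> r \<le> Suc N \<and> 1 \<le> c \<and> c \<le> mu r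
     then if r \<le> N \<and> c \<le> \<nu> r then T r c else Suc N else 0)"

text \<open>Columns increase strictly from an entry that is at least 1. In the last row this forces
  every entry to equal n.\<close>

lemma SSYT_entry_ge_row:
  assumes T: "T \<in> SSYT n mu" and mu: "\<And>i. 1 \<le> i \<Longrightarrow> i < n \<Longrightarrow> mu (Suc i) \<le> mu i"
    and r: "1 \<le> r" "r \<le> n" "1 \<le> c" "c \<le> mu r"
  shows "r \<le> T r c"
  using r(1,2,4)
proof (induction r rule: nat_induct_at_least)
  case base
  then show ?case using T r(3) by (auto simp: SSYT_def)
next
  case (Suc r)
  then have "c \<le> mu r" using mu[of r] by auto
  then have "r \<le> T r c" "T r c < T (Suc r) c"
    using Suc T r(3) by (auto simp: SSYT_def)
  then show ?case by simp
qed

text \<open>The box above any box of mu in row r + 1 lies in \<nu>, because mu (r + 1) <= \<nu> r.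
  So no column contains the new entry Suc N twice.\<close>

lemma SSYT_extend_tableau:
  assumes \<nu>: "\<nu> \<in> interlacing_below N mu" and T: "T \<in> SSYT N \<nu>"
  shows "extend_tableau N mu \<nu> T \<in> SSYT (Suc N) mu"
proof -
  have T1: "1 \<le> T r c \<and> T r c \<le> N" if "1 \<le> r" "r \<le> N" "1 \<le> c" "c \<le> \<nu> r" for r c
    using T that by (auto simp: SSYT_def)
  have T2: "T r c \<le> T r (Suc c)" if "1 \<le> r" "r \<le> N" "1 \<le> c" "Suc c \<le> \<nu> r" for r c
    using T that by (auto simp: SSYT_def)
  have T3: "T r c < T (Suc r) c" if "1 \<le> r" "Suc r \<le> N" "1 \<le> c" "c \<le> \<nu> (Suc r)" for r c
    using T that by (auto simp: SSYT_def)
  have V: "mu (Suc i) \<le> \<nu> i" "\<nu> i \<le> mu i" if "1 \<le> i" "i \<le> N" for i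
    using \<nu> that by (auto simp: interlacing_below_def)
  let ?E = "extend_tableau N mu \<nu> T"
  have E: "?E r c = (if r \<le> N \<and> c \<le> \<nu> r then T r c else Suc N)"
    if "1 \<le> r" "r \<le> Suc N" "1 \<le> c" "c \<le> mu r" for r c
    using that by (simp add: extend_tableau_def)
  have "1 \<le> ?E r c \<and> ?E r c \<le> Suc N" if "1 \<le> r" "r \<le> Suc N" "1 \<le> c" "c \<le> mu r" for r c
    using E[OF that] T1[of r c] that by auto
  moreover have "?E r c \<le> ?E r (Suc c)" if "1 \<le> r" "r \<le> Suc N" "1 \<le> c" "Suc c \<le> mu r" for r c
    using E[of r c] E[of r "Suc c"] T1[of r c] T2[of r c] that by auto
  moreover have "?E r c < ?E (Suc r) c" if "1 \<le> r" "Suc r \<le> Suc N" "1 \<le> c" "c \<le> mu (Suc r)" for r c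
  proof -
    have "c \<le> \<nu> r" "c \<le> mu r" using V[of r] that by auto
    then show ?thesis using E[of r c] E[of "Suc r" c] T1[of r c] T3[of r c] that by auto
  qed
  ultimately show ?thesis
    by (auto simp: SSYT_def extend_tableau_def[of N mu \<nu> T])
qed

text \<open>Rows increase weakly, so the small entries of a row are counted by the column in which
  they end. This recovers a shape from cardinalities.\<close>

lemma SSYT_row_initial_segment:
  assumes T: "T \<in> SSYT n mu" and r: "1 \<le> r" "r \<le> n"
  shows "{c \<in> {1..mu r}. T r c \<le> m} = {1..card {c \<in> {1..mu r}. T r c \<le> m}}"
proof -
  let ?A = "{c \<in> {1..mu r}. T r c \<le> m}"
  have mono: "T r c \<le> T r c'" if "1 \<le> c" "c \<le> c'" "c' \<le> mu r" for c c'
    using that(2,3)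
  proof (induction c' rule: dec_induct)
    case (step c')
    then have "T r c' \<le> T r (Suc c')" using T r that(1) by (auto simp: SSYT_def)
    then show ?case using step by simp
  qed simp
  show ?thesis
  proof (cases "?A = {}")
    case False
    have fin: "finite ?A" by simp
    define M where "M = Max ?A"
    have M: "M \<in> ?A" "\<And>c. c \<in> ?A \<Longrightarrow> c \<le> M"
      using Max_in[OF fin False] Max_ge[OF fin] by (auto simp: M_def)
    have "?A = {1..M}"
    proof
      show "{1..M} \<subseteq> ?A"
      proof
        fix c assume "c \<in> {1..M}"
        then show "c \<in> ?A" using M(1) mono[of c M] by auto
      qed
    qed (use M(2) in auto)
    then show ?thesis by simp
  qed simp
qed

lemma bij_betw_extend_tableau:
  assumes mu: "\<And>i. 1 \<le> i \<Longrightarrow> i \<le> N \<Longrightarrow> mu (Suc i) \<le> mu i"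
  shows "bij_betw (\<lambda>(\<nu>, T). extend_tableau N mu \<nu> T) (SIGMA \<nu>:interlacing_below N mu. SSYT N \<nu>) (SSYT (Suc N) mu)"
proof -
  \<comment> \<open>The inverse map: \<open>sh\<close> is the shape occupied by the entries at most
    N, and \<open>rs\<close> erases the entries Suc N.\<close>
  define sh where "sh T = (\<lambda>r. if r \<in> {1..N} then card {c \<in> {1..mu r}. T r c \<le> N} else 0)" for T :: "nat \<Rightarrow> nat \<Rightarrow> nat"
  define rs where "rs T = (\<lambda>r c. if T r c = Suc N then 0 else T r c)" for T :: "nat \<Rightarrow> nat \<Rightarrow> nat"
  have 1: "sh (extend_tableau N mu \<nu> T) = \<nu> \<and> rs (extend_tableau N mu \<nu> T) = T"
    if \<nu>: "\<nu> \<in> interlacing_below N mu" and T: "T \<in> SSYT N \<nu>" for \<nu> T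
  proof
    have V: "mu (Suc i) \<le> \<nu> i" "\<nu> i \<le> mu i" if "1 \<le> i" "i \<le> N" for i
      using \<nu> that by (auto simp: interlacing_below_def)
    have V0: "\<nu> i = 0" if "\<not> (1 \<le> i \<and> i \<le> N)" for i
      using \<nu> that by (auto simp: interlacing_below_def)
    have T1: "1 \<le> T r c \<and> T r c \<le> N" if "1 \<le> r" "r \<le> N" "1 \<le> c" "c \<le> \<nu> r" for r c
      using T that by (auto simp: SSYT_def)
    have T0: "T r c = 0" if "\<not> (1 \<le> r \<and> r \<le> N \<and> 1 \<le> c \<and> c \<le> \<nu> r)" for r c
      using T that by (auto simp: SSYT_def)
    have "{c \<in> {1..mu r}. extend_tableau N mu \<nu> T r c \<le> N} = {1..\<nu> r}" if "1 \<le> r" "r \<le> N" for r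
      using V[OF that] T1[OF that] that by (auto simp: extend_tableau_def)
    then show "sh (extend_tableau N mu \<nu> T) = \<nu>"
      by (auto simp: sh_def fun_eq_iff V0)
    have "rs (extend_tableau N mu \<nu> T) r c = T r c" for r c
    proof (cases "1 \<le> r \<and> r \<le> N \<and> 1 \<le> c \<and> c \<le> \<nu> r")
      case True
      then have "c \<le> mu r" using V[of r] by auto
      then show ?thesis using True T1[of r c] by (auto simp: rs_def extend_tableau_def)
    next
      case False
      then show ?thesis using T0[OF False] by (auto simp: rs_def extend_tableau_def)
    qed
    then show "rs (extend_tableau N mu \<nu> T) = T" by blast
  qed
  have 2: "extend_tableau N mu (sh T) (rs T) = T \<and> sh T \<in> interlacing_below N mu \<and> rs T \<in> SSYT N (sh T)"
    if T: "T \<in> SSYT (Suc N) mu" for T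
  proof -
    have T0: "T r c = 0" if "\<not> (1 \<le> r \<and> r \<le> Suc N \<and> 1 \<le> c \<and> c \<le> mu r)" for r c
      using T that by (auto simp: SSYT_def)
    have T1: "1 \<le> T r c" "T r c \<le> Suc N" if "1 \<le> r" "r \<le> Suc N" "1 \<le> c" "c \<le> mu r" for r c
      using T that by (auto simp: SSYT_def)
    have T2: "T r c \<le> T r (Suc c)" if "1 \<le> r" "r \<le> Suc N" "1 \<le> c" "Suc c \<le> mu r" for r c
      using T that by (auto simp: SSYT_def)
    have T3: "T r c < T (Suc r) c" if "1 \<le> r" "r \<le> N" "1 \<le> c" "c \<le> mu (Suc r)" for r c
      using T that by (auto simp: SSYT_def)
    have sh: "T r c \<le> N \<longleftrightarrow> c \<le> sh T r" if "1 \<le> r" "r \<le> N" "1 \<le> c" "c \<le> mu r" for r c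
    proof -
      have "c \<in> {c \<in> {1..mu r}. T r c \<le> N} \<longleftrightarrow> c \<in> {1..sh T r}"
        using SSYT_row_initial_segment[OF T, of r N] that by (simp add: sh_def)
      then show ?thesis using that by auto
    qed
    have sh_le: "sh T r \<le> mu r" if "1 \<le> r" "r \<le> N" for r
    proof -
      have "card {c \<in> {1..mu r}. T r c \<le> N} \<le> card {1..mu r}" by (intro card_mono) auto
      then show ?thesis using that by (simp add: sh_def)
    qed
    \<comment> \<open>The entry above the last box of row r + 1 is smaller than an entry that is at
      most Suc N, so it survives the erasure.\<close>
    have sh_ge: "mu (Suc r) \<le> sh T r" if r: "1 \<le> r" "r \<le> N" for r
    proof (cases "mu (Suc r) = 0")
      case False
      let ?c = "mu (Suc r)"
      have "T r ?c < T (Suc r) ?c" "T (Suc r) ?c \<le> Suc N"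
        using T3[of r ?c] T1[of "Suc r" ?c] False r by auto
      then show ?thesis using sh[of r ?c] mu[OF r] False r by auto
    qed simp
    have last: "T (Suc N) c = Suc N" if "1 \<le> c" "c \<le> mu (Suc N)" for c
      using SSYT_entry_ge_row[OF T, of "Suc N" c] mu T1[of "Suc N" c] that by auto
    have V: "sh T \<in> interlacing_below N mu"
      using sh_le sh_ge by (auto simp: interlacing_below_def sh_def[of T])
    have "extend_tableau N mu (sh T) (rs T) r c = T r c" for r c
    proof (cases "1 \<le> r \<and> r \<le> Suc N \<and> 1 \<le> c \<and> c \<le> mu r")
      case True
      show ?thesis
      proof (cases "r \<le> N")
        case r: True
        then show ?thesis using True sh[of r c] T1[of r c] by (auto simp: extend_tableau_def rs_def)
      next
        case False
        then have "r = Suc N" using True by auto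
        then show ?thesis using True last[of c] by (auto simp: extend_tableau_def)
      qed
    next
      case False
      then show ?thesis using T0[OF False] by (auto simp: extend_tableau_def)
    qed
    moreover have "rs T \<in> SSYT N (sh T)"
    proof -
      have r0: "rs T r c = 0" if out: "\<not> (1 \<le> r \<and> r \<le> N \<and> 1 \<le> c \<and> c \<le> sh T r)" for r c
      proof (cases "1 \<le> r \<and> r \<le> Suc N \<and> 1 \<le> c \<and> c \<le> mu r")
        case True
        have "T r c = Suc N"
        proof (cases "r \<le> N")
          case r: True
          then have "\<not> T r c \<le> N" using True sh[of r c] out by auto
          then show ?thesis using True T1[of r c] by auto
        next
          case False
          then have "r = Suc N" using True by auto
          then show ?thesis using True last[of c] by auto
        qed
        then show ?thesis by (simp add: rs_def)
      next
        case False
        then show ?thesis using T0[OF False] by (simp add: rs_def)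
      qed
      have in_sh: "rs T r c = T r c \<and> 1 \<le> T r c \<and> T r c \<le> N" if "1 \<le> r" "r \<le> N" "1 \<le> c" "c \<le> sh T r" for r c
        using sh[of r c] sh_le[of r] T1[of r c] that by (auto simp: rs_def)
      have r2: "rs T r c \<le> rs T r (Suc c)" if "1 \<le> r" "r \<le> N" "1 \<le> c" "Suc c \<le> sh T r" for r c
        using in_sh[of r c] in_sh[of r "Suc c"] T2[of r c] sh_le[of r] that by auto
      have r3: "rs T r c < rs T (Suc r) c" if "1 \<le> r" "Suc r \<le> N" "1 \<le> c" "c \<le> sh T (Suc r)" for r c
        using in_sh[of r c] in_sh[of "Suc r" c] T3[of r c] sh_le[of "Suc r"] sh_ge[of r] that by auto
      show ?thesis
        unfolding SSYT_def
      proof (intro CollectI conjI allI impI, goal_cases)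
        case (1 r c) then show ?case by (rule r0)
      next
        case (2 r c) then show ?case using in_sh[of r c] by auto
      next
        case (3 r c) then show ?case using in_sh[of r c] by auto
      next
        case (4 r c) then show ?case using r2[of r c] by auto
      next
        case (5 r c) then show ?case using r3[of r c] by auto
      qed
    qed
    ultimately show ?thesis using V by blast
  qed
  show ?thesis
  proof (rule bij_betw_byWitness[where f' = "\<lambda>T. (sh T, rs T)"])
    show "\<forall>x\<in>SIGMA \<nu>:interlacing_below N mu. SSYT N \<nu>.
        (sh (case x of (\<nu>, T) \<Rightarrow> extend_tableau N mu \<nu> T), rs (case x of (\<nu>, T) \<Rightarrow> extend_tableau N mu \<nu> T)) = x"
      by (clarsimp simp: 1)
    show "\<forall>T\<in>SSYT (Suc N) mu. (case (sh T, rs T) of (\<nu>, T) \<Rightarrow> extend_tableau N mu \<nu> T) = T"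
      by (simp add: 2)
    show "(\<lambda>(\<nu>, T). extend_tableau N mu \<nu> T) ` (SIGMA \<nu>:interlacing_below N mu. SSYT N \<nu>) \<subseteq> SSYT (Suc N) mu"
      by (clarsimp simp: SSYT_extend_tableau)
    show "(\<lambda>T. (sh T, rs T)) ` SSYT (Suc N) mu \<subseteq> (SIGMA \<nu>:interlacing_below N mu. SSYT N \<nu>)"
      using 2 by blast
  qed
qed

lemma prod_diagram:
  fixes mu :: "nat \<Rightarrow> nat"
  shows "(\<Prod>(r, c) \<in> {(r, c). 1 \<le> r \<and> r \<le> n \<and> 1 \<le> c \<and> c \<le> mu r}. f r c) = (\<Prod>r = 1..n. \<Prod>c = 1..mu r. f r c)"
proof -
  have "{(r, c). 1 \<le> r \<and> r \<le> n \<and> 1 \<le> c \<and> c \<le> mu r} = (SIGMA r:{1..n}. {1..mu r})"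
    by auto
  moreover have "(\<Prod>(r, c) \<in> (SIGMA r:{1..n}. {1..mu r}). f r c) = (\<Prod>r = 1..n. \<Prod>c = 1..mu r. f r c)"
    by (rule prod.Sigma [symmetric]) auto
  ultimately show ?thesis by (simp only:)
qed

lemma extend_tableau_weight:
  fixes X :: "nat \<Rightarrow> 'a::comm_ring_1"
  assumes \<nu>: "\<nu> \<in> interlacing_below N mu"
  shows "(\<Prod>r = 1..Suc N. \<Prod>c = 1..mu r. X (extend_tableau N mu \<nu> T r c)) =
    X (Suc N) ^ ((\<Sum>r = 1..Suc N. mu r) - (\<Sum>r = 1..N. \<nu> r)) * (\<Prod>r = 1..N. \<Prod>c = 1..\<nu> r. X (T r c))"
proof -
  have V: "\<nu> i \<le> mu i" if "i \<in> {1..N}" for i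
    using \<nu> that by (auto simp: interlacing_below_def)
  have row: "(\<Prod>c = 1..mu r. X (extend_tableau N mu \<nu> T r c)) =
      X (Suc N) ^ (mu r - \<nu> r) * (\<Prod>c = 1..\<nu> r. X (T r c))" if r: "r \<in> {1..N}" for r
  proof -
    have eq: "{1..mu r} = {1..\<nu> r} \<union> {Suc (\<nu> r)..mu r}" using V[OF r] by auto
    have "(\<Prod>c = 1..mu r. X (extend_tableau N mu \<nu> T r c)) =
       (\<Prod>c = 1..\<nu> r. X (extend_tableau N mu \<nu> T r c)) * (\<Prod>c = Suc (\<nu> r)..mu r. X (extend_tableau N mu \<nu> T r c))"
      unfolding eq by (subst prod.union_disjoint) auto
    also have "(\<Prod>c = 1..\<nu> r. X (extend_tableau N mu \<nu> T r c)) = (\<Prod>c = 1..\<nu> r. X (T r c))"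
      using r V[OF r] by (intro prod.cong) (auto simp: extend_tableau_def)
    also have "(\<Prod>c = Suc (\<nu> r)..mu r. X (extend_tableau N mu \<nu> T r c)) = (\<Prod>c = Suc (\<nu> r)..mu r. X (Suc N))"
      using r by (intro prod.cong) (auto simp: extend_tableau_def)
    finally show ?thesis by (simp add: mult.commute)
  qed
  have "(\<Prod>c = 1..mu (Suc N). X (extend_tableau N mu \<nu> T (Suc N) c)) = (\<Prod>c = 1..mu (Suc N). X (Suc N))"
    by (intro prod.cong) (auto simp: extend_tableau_def)
  then have last: "(\<Prod>c = 1..mu (Suc N). X (extend_tableau N mu \<nu> T (Suc N) c)) = X (Suc N) ^ mu (Suc N)"
    by simp
  \<comment> \<open>Needed so that the difference of the two sizes, taken in the naturals, is not
    truncated.\<close>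
  have le: "(\<Sum>r = 1..N. \<nu> r) \<le> (\<Sum>r = 1..N. mu r)" by (intro sum_mono V)
  have "(\<Sum>r = 1..N. mu r - \<nu> r) = (\<Sum>r = 1..N. mu r) - (\<Sum>r = 1..N. \<nu> r)"
    using V by (intro sum_subtractf_nat) auto
  then have e: "(\<Sum>r = 1..Suc N. mu r) - (\<Sum>r = 1..N. \<nu> r) = (\<Sum>r = 1..N. mu r - \<nu> r) + mu (Suc N)"
    using le by simp
  have "(\<Prod>r = 1..N. \<Prod>c = 1..mu r. X (extend_tableau N mu \<nu> T r c)) =
      (\<Prod>r = 1..N. X (Suc N) ^ (mu r - \<nu> r) * (\<Prod>c = 1..\<nu> r. X (T r c)))"
    by (intro prod.cong refl row)
  then show ?thesis
    unfolding e by (simp add: last [simplified] prod.distrib power_sum power_add ac_simps)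
qed

lemma finite_interlacing_below: "finite (interlacing_below N mu)"
proof -
  have "finite {f. \<forall>j. (j \<in> {1..N} \<longrightarrow> f j \<in> (\<Union>i\<in>{1..N}. {..mu i})) \<and> (j \<notin> {1..N} \<longrightarrow> f j = 0)}"
    by (rule finite_set_of_finite_funs) auto
  then show ?thesis
    by (rule rev_finite_subset) (force simp: interlacing_below_def)
qed

lemma SSYT_0: "SSYT 0 mu = {\<lambda>r c. 0}"
  by (auto simp: SSYT_def fun_eq_iff)

lemma finite_SSYT: "finite (SSYT n mu)"
proof -
  have "SSYT n mu \<subseteq> {f. \<forall>r. (r \<in> {1..n} \<longrightarrow> f r \<in> {g. \<forall>c. (c \<in> {1..(\<Sum>i = 1..n. mu i)} \<longrightarrow> g c \<in> {..n}) \<and> (c \<notin> {1..(\<Sum>i = 1..n. mu i)} \<longrightarrow> g c = 0)})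
      \<and> (r \<notin> {1..n} \<longrightarrow> f r = (\<lambda>c. 0))}"
  proof
    fix T assume T: "T \<in> SSYT n mu"
    have z: "T r c = 0" if "\<not> (1 \<le> r \<and> r \<le> n \<and> 1 \<le> c \<and> c \<le> mu r)" for r c
      using T that by (auto simp: SSYT_def)
    have le: "T r c \<le> n" for r c
      using T z[of r c] by (cases "1 \<le> r \<and> r \<le> n \<and> 1 \<le> c \<and> c \<le> mu r") (auto simp: SSYT_def)
    have "mu r \<le> (\<Sum>i = 1..n. mu i)" if "r \<in> {1..n}" for r
      using that by (intro member_le_sum) auto
    then have "T r c = 0" if "r \<in> {1..n}" "c \<notin> {1..(\<Sum>i = 1..n. mu i)}" for r c
      using that by (intro z) fastforce
    then show "T \<in> {f. \<forall>r. (r \<in> {1..n} \<longrightarrow> f r \<in> {g. \<forall>c. (c \<in> {1..(\<Sum>i = 1..n. mu i)} \<longrightarrow> g c \<in> {..n}) \<and> (c \<notin> {1..(\<Sum>i = 1..n. mu i)} \<longrightarrow> g c = 0)})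
      \<and> (r \<notin> {1..n} \<longrightarrow> f r = (\<lambda>c. 0))}"
      using le z by (auto simp: fun_eq_iff)
  qed
  moreover have "finite \<dots>"
    by (intro finite_set_of_finite_funs) auto
  ultimately show ?thesis by (rule finite_subset)
qed

lemma schur_branching:
  fixes X :: "nat \<Rightarrow> 'a::comm_ring_1"
  assumes mu: "\<And>i. 1 \<le> i \<Longrightarrow> i \<le> N \<Longrightarrow> mu (Suc i) \<le> mu i"
  shows "schur (Suc N) mu X = (\<Sum>\<nu>\<in>interlacing_below N mu.
    X (Suc N) ^ ((\<Sum>r = 1..Suc N. mu r) - (\<Sum>r = 1..N. \<nu> r)) * schur N \<nu> X)"
proof -
  have "schur (Suc N) mu X = (\<Sum>(\<nu>, T)\<in>(SIGMA \<nu>:interlacing_below N mu. SSYT N \<nu>).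
      \<Prod>r = 1..Suc N. \<Prod>c = 1..mu r. X (extend_tableau N mu \<nu> T r c))"
    unfolding schur_def prod_diagram
    by (subst sum.reindex_bij_betw[OF bij_betw_extend_tableau[where N = N and mu = mu, OF mu], symmetric])
       (auto simp: case_prod_unfold)
  also have "\<dots> = (\<Sum>(\<nu>, T)\<in>(SIGMA \<nu>:interlacing_below N mu. SSYT N \<nu>).
      X (Suc N) ^ ((\<Sum>r = 1..Suc N. mu r) - (\<Sum>r = 1..N. \<nu> r)) * (\<Prod>r = 1..N. \<Prod>c = 1..\<nu> r. X (T r c)))"
    by (rule sum.cong[OF refl]) (auto simp only: mem_Sigma_iff extend_tableau_weight split: prod.splits)
  also have "\<dots> = (\<Sum>\<nu>\<in>interlacing_below N mu. \<Sum>T\<in>SSYT N \<nu>.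
      X (Suc N) ^ ((\<Sum>r = 1..Suc N. mu r) - (\<Sum>r = 1..N. \<nu> r)) * (\<Prod>r = 1..N. \<Prod>c = 1..\<nu> r. X (T r c)))"
    by (rule sum.Sigma [symmetric]) (use finite_SSYT finite_interlacing_below in auto)
  finally show ?thesis
    unfolding schur_def prod_diagram sum_distrib_left .
qed

section \<open>The bialternant formula for partitions\<close>

text \<open>The trivial weight kills every decorated lower row. For weakly increasing k the
  intervals are ordinary ones with sign 1, and the recursion becomes a sum over interlacing
  rows.\<close>

lemma alternant_branching_trivial:
  fixes X :: "nat \<Rightarrow> 'a::field"
  assumes inj: "inj_on X {1..Suc N}" and nz: "\<And>i. i \<in> {1..Suc N} \<Longrightarrow> X i \<noteq> 0"
    and k: "\<And>j. j \<in> {1..N} \<Longrightarrow> k j \<le> k (Suc j)"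
  shows "(\<Sum>l | (\<forall>j. j \<notin> {1..N} \<longrightarrow> l j = 0) \<and> (\<forall>j\<in>{1..N}. k j \<le> l j \<and> l j \<le> k (Suc j)).
      X (Suc N) powi ((\<Sum>i = 1..Suc N. k i) - (\<Sum>j = 1..N. l j)) * (alternant N trivial_weight X l / vandermonde N X)) =
    alternant (Suc N) trivial_weight X k / vandermonde (Suc N) X"
proof -
  let ?e = "\<lambda>j::nat. Empty"
  let ?G = "\<lambda>d. \<Sum>l\<in>upper_rows N k d. row_weight N trivial_weight (X (Suc N)) k d l * (alternant N trivial_weight X l / vandermonde N X)"
  have z: "?G d = 0" if "d \<in> row_decs (Suc N) - {?e}" for d
  proof -
    from that obtain j where "d j \<noteq> Empty" "j \<in> {1..Suc N}"
      by (auto simp: row_decs_def fun_eq_iff)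
    then have "\<exists>j\<in>{1..Suc N}. trivial_weight (d j) = (0 :: 'a)"
      by (auto simp: trivial_weight_def)
    then have "(\<Prod>i = 1..Suc N. trivial_weight (d i) :: 'a) = 0"
      by (intro prod_zero) auto
    then have "row_weight N trivial_weight (X (Suc N)) k d l = 0" for l
      unfolding row_weight_def by (simp only: mult_zero_left mult_zero_right)
    then show ?thesis by simp
  qed
  have rows: "upper_rows N k ?e = {l. (\<forall>j. j \<notin> {1..N} \<longrightarrow> l j = 0) \<and> (\<forall>j\<in>{1..N}. k j \<le> l j \<and> l j \<le> k (Suc j))}"
    using k by (fastforce simp: upper_rows_def in_sint_def eps_def delta_def)
  have "sint_sign (k j) (k (Suc j)) = (1 :: 'a)" if "j \<in> {1..N}" for j
    using k[OF that] by (simp add: sint_sign_def neg_sint_def)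
  then have w: "row_weight N trivial_weight (X (Suc N)) k ?e l =
      X (Suc N) powi ((\<Sum>i = 1..Suc N. k i) - (\<Sum>j = 1..N. l j))" for l
    by (simp add: row_weight_def eps_def delta_def trivial_weight_def del: sum.cl_ivl_Suc)
  have "(\<Sum>d\<in>row_decs (Suc N). ?G d) = ?G ?e + (\<Sum>d\<in>row_decs (Suc N) - {?e}. ?G d)"
    by (rule sum.remove) (auto simp: finite_row_decs, simp add: row_decs_def)
  also have "\<dots> = ?G ?e" using z by simp
  finally show ?thesis
    using alternant_branching[OF inj nz, of trivial_weight k] unfolding rows w by simp
qed

text \<open>Both sides obey the same branching rule. Partitions decrease while the rows of triangles
  increase, hence the reversal n + 1 - i.\<close>

lemma schur_alternant:
  fixes X :: "nat \<Rightarrow> 'a::field"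
  assumes "inj_on X {1..n}" "\<And>i. i \<in> {1..n} \<Longrightarrow> X i \<noteq> 0"
    and "\<And>i. 1 \<le> i \<Longrightarrow> i < n \<Longrightarrow> mu (Suc i) \<le> mu i"
  shows "schur n mu X = alternant n trivial_weight X (\<lambda>i. int (mu (n + 1 - i))) / vandermonde n X"
  using assms
proof (induction n arbitrary: mu)
  case 0
  have "index_pair_set 0 = {}" by (auto simp: index_pair_set_def)
  moreover have "schur 0 mu X = 1"
    unfolding schur_def prod_diagram SSYT_0 by simp
  ultimately show ?case
    by (simp add: alternant_def vandermonde_def alternant_term_def)
next
  case (Suc N)
  have mu: "mu (Suc i) \<le> mu i" if "1 \<le> i" "i \<le> N" for i
    using Suc.prems(3)[of i] that by simp
  define k where "k i = int (mu (Suc N + 1 - i))" for i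
  let ?L = "{l. (\<forall>j. j \<notin> {1..N} \<longrightarrow> l j = 0) \<and> (\<forall>j\<in>{1..N}. k j \<le> l j \<and> l j \<le> k (Suc j))}"
  let ?x = "X (Suc N)"
  have "schur (Suc N) mu X = (\<Sum>\<nu>\<in>interlacing_below N mu.
     ?x ^ ((\<Sum>r = 1..Suc N. mu r) - (\<Sum>r = 1..N. \<nu> r)) * schur N \<nu> X)"
    by (rule schur_branching) (use mu in auto)
  also have "\<dots> = (\<Sum>l\<in>?L. ?x powi ((\<Sum>i = 1..Suc N. k i) - (\<Sum>j = 1..N. l j)) *
      (alternant N trivial_weight X l / vandermonde N X))"
  \<comment> \<open>Outside {1..N} the reversed index is N + 1 (for argument 0) or 0 (for arguments
    above N, by truncated subtraction); the defaults 0 at both places keep the maps mutually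
    inverse.\<close>
  proof (rule sum.reindex_bij_witness[where
        j = "\<lambda>\<nu> j. int (\<nu> (N + 1 - j))" and i = "\<lambda>l i. nat (l (N + 1 - i))"])
    fix \<nu> assume \<nu>: "\<nu> \<in> interlacing_below N mu"
    have V: "mu (Suc i) \<le> \<nu> i" "\<nu> i \<le> mu i" if "1 \<le> i" "i \<le> N" for i
      using \<nu> that by (auto simp: interlacing_below_def)
    have V0: "\<nu> i = 0" if "\<not> (1 \<le> i \<and> i \<le> N)" for i
      using \<nu> that by (auto simp: interlacing_below_def)
    show "(\<lambda>i. nat (int (\<nu> (N + 1 - (N + 1 - i))))) = \<nu>"
    proof
      fix i show "nat (int (\<nu> (N + 1 - (N + 1 - i)))) = \<nu> i"
        using V0[of i] V0[of "N + 1"] by (cases "i \<le> N + 1") auto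
    qed
    have "k j \<le> int (\<nu> (N + 1 - j)) \<and> int (\<nu> (N + 1 - j)) \<le> k (Suc j)" if "j \<in> {1..N}" for j
      using V[of "N + 1 - j"] that by (auto simp: k_def Suc_diff_le)
    moreover have "int (\<nu> (N + 1 - j)) = 0" if "j \<notin> {1..N}" for j
      using V0[of "N + 1 - j"] that by (cases "j = 0") auto
    ultimately show "(\<lambda>j. int (\<nu> (N + 1 - j))) \<in> ?L" by blast
    have s1: "(\<Sum>j = 1..N. int (\<nu> (N + 1 - j))) = int (\<Sum>r = 1..N. \<nu> r)"
      using sum.atLeastAtMost_rev[of "\<lambda>r. int (\<nu> r)" 1 N] by simp
    have s2: "(\<Sum>i = 1..Suc N. k i) = int (\<Sum>r = 1..Suc N. mu r)"
      using sum.atLeastAtMost_rev[of "\<lambda>r. int (mu r)" 1 "Suc N"] unfolding k_def of_nat_sum by simp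
    have le: "(\<Sum>r = 1..N. \<nu> r) \<le> (\<Sum>r = 1..Suc N. mu r)"
      using sum_mono[of "{1..N}" \<nu> mu] V by simp
    have dec: "\<nu> (Suc i) \<le> \<nu> i" if "1 \<le> i" "i < N" for i
      using V[of i] V[of "Suc i"] that by auto
    have "schur N \<nu> X = alternant N trivial_weight X (\<lambda>j. int (\<nu> (N + 1 - j))) / vandermonde N X"
      using Suc.prems dec by (intro Suc.IH) (auto intro: inj_on_subset)
    moreover have "?x powi ((\<Sum>i = 1..Suc N. k i) - (\<Sum>j = 1..N. int (\<nu> (N + 1 - j)))) =
        ?x ^ ((\<Sum>r = 1..Suc N. mu r) - (\<Sum>r = 1..N. \<nu> r))"
      unfolding s1 s2 using le by (metis of_nat_diff power_int_of_nat)
    ultimately show "?x powi ((\<Sum>i = 1..Suc N. k i) - (\<Sum>j = 1..N. int (\<nu> (N + 1 - j)))) *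
      (alternant N trivial_weight X (\<lambda>j. int (\<nu> (N + 1 - j))) / vandermonde N X) =
      ?x ^ ((\<Sum>r = 1..Suc N. mu r) - (\<Sum>r = 1..N. \<nu> r)) * schur N \<nu> X" by simp
  next
    fix l assume "l \<in> ?L"
    then have L: "k j \<le> l j" "l j \<le> k (Suc j)" if "1 \<le> j" "j \<le> N" for j
      using that by auto
    have L0: "l j = 0" if "\<not> (1 \<le> j \<and> j \<le> N)" for j
      using \<open>l \<in> ?L\<close> that by auto
    have pos: "0 \<le> l j" for j
      using L[of j] L0[of j] by (cases "1 \<le> j \<and> j \<le> N") (auto simp: k_def)
    show "(\<lambda>j. int (nat (l (N + 1 - (N + 1 - j))))) = l"
    proof
      fix j show "int (nat (l (N + 1 - (N + 1 - j)))) = l j"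
        using L0[of j] L0[of "N + 1"] pos[of j] by (cases "j \<le> N + 1") auto
    qed
    have "mu (Suc i) \<le> nat (l (N + 1 - i)) \<and> nat (l (N + 1 - i)) \<le> mu i" if "i \<in> {1..N}" for i
    proof -
      have "1 \<le> N + 1 - i" "N + 1 - i \<le> N" using that by auto
      from L[OF this] show ?thesis
        using that pos by (auto simp: k_def Suc_diff_le nat_le_iff le_nat_iff)
    qed
    moreover have "nat (l (N + 1 - i)) = 0" if "i \<notin> {1..N}" for i
      using L0[of "N + 1 - i"] that by (cases "i = 0") auto
    ultimately show "(\<lambda>i. nat (l (N + 1 - i))) \<in> interlacing_below N mu"
      by (auto simp: interlacing_below_def)
  qed
  also have "\<dots> = alternant (Suc N) trivial_weight X k / vandermonde (Suc N) X"
    by (rule alternant_branching_trivial) (use Suc.prems mu in \<open>auto simp: k_def Suc_diff_le\<close>)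
  finally show ?case by (simp only: k_def [abs_def])
qed

section \<open>From partitions to arbitrary integer sequences\<close>

text \<open>Places a and b carry the same exponent: the alternant has two equal columns.\<close>

lemma alternant_eq_0:
  fixes X :: "nat \<Rightarrow> 'a::field"
  assumes ab: "a \<in> {1..n}" "b \<in> {1..n}" "a \<noteq> b" and k: "k a + int a = k b + int b"
  shows "alternant n trivial_weight X k = 0"
  unfolding alternant_def
proof (rule sum_signed_permutes_eq_0[OF _ ab])
  fix \<sigma> :: "nat \<Rightarrow> nat"
  let ?t = "transpose a b"
  have t: "?t permutes {1..n}" using ab by (intro permutes_swap_id)
  have "(\<Prod>i = 1..n. X (\<sigma> (?t i)) powi (k i + int i - 1)) = (\<Prod>i = 1..n. X (\<sigma> (?t i)) powi (k (?t i) + int (?t i) - 1))"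
    using k by (intro prod.cong) (auto simp: transpose_def)
  also have "\<dots> = (\<Prod>i = 1..n. X (\<sigma> i) powi (k i + int i - 1))"
    using prod.permute[OF t, of "\<lambda>i. X (\<sigma> i) powi (k i + int i - 1)"] by (simp add: comp_def)
  finally show "alternant_term n trivial_weight k (X \<circ> (\<sigma> \<circ> ?t)) = alternant_term n trivial_weight k (X \<circ> \<sigma>)"
    by (simp add: alternant_term_def case_prod_unfold)
qed simp

text \<open>Permuting the exponents costs a sign, and raising all of them by p pulls out a power of
  the product of the variables. These are the two normalizations, sorting and shifting, in
  \<open>ext_schur\<close>.\<close>

lemma alternant_permute:
  fixes X :: "nat \<Rightarrow> 'a::field"
  assumes \<rho>: "\<rho> permutes {1..n}" and nz: "\<And>i. i \<in> {1..n} \<Longrightarrow> X i \<noteq> 0"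
    and \<kappa>: "\<And>i. i \<in> {1..n} \<Longrightarrow> \<kappa> i + int i = k (\<rho> i) + int (\<rho> i) + p"
  shows "alternant n trivial_weight X \<kappa> = of_int (sign \<rho>) * (\<Prod>i = 1..n. X i powi p) * alternant n trivial_weight X k"
proof -
  let ?S = "{\<tau>. \<tau> permutes {1..n}}"
  let ?g = "\<lambda>\<tau>. \<Prod>i = 1..n. X (\<tau> i) powi (k i + int i - 1)"
  have "alternant n trivial_weight X \<kappa> = (\<Sum>\<tau>\<in>?S. of_int (sign \<tau>) * (\<Prod>i = 1..n. X (\<tau> i) powi (\<kappa> i + int i - 1)))"
    by (simp add: alternant_def alternant_term_def case_prod_unfold)
  also have "\<dots> = (\<Sum>\<tau>\<in>?S. of_int (sign (\<tau> \<circ> \<rho>)) * (\<Prod>i = 1..n. X ((\<tau> \<circ> \<rho>) i) powi (\<kappa> i + int i - 1)))"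
    by (rule sum_permutations_compose_right[OF \<rho>])
  also have "\<dots> = (\<Sum>\<tau>\<in>?S. of_int (sign \<rho>) * (\<Prod>i = 1..n. X i powi p) * (of_int (sign \<tau>) * ?g \<tau>))"
  proof (rule sum.cong[OF refl])
    fix \<tau> assume "\<tau> \<in> ?S"
    then have \<tau>: "\<tau> permutes {1..n}" by simp
    have nz\<tau>: "X (\<tau> i) \<noteq> 0" if "i \<in> {1..n}" for i
      using permutes_in_image[OF \<tau>, of i] nz[of "\<tau> i"] that by simp
    have "permutation \<tau>" "permutation \<rho>"
      using \<tau> \<rho> by (auto intro: permutes_imp_permutation[of "{1..n}"])
    then have s: "sign (\<tau> \<circ> \<rho>) = sign \<tau> * sign \<rho>" by (rule sign_compose)
    have "(\<Prod>i = 1..n. X ((\<tau> \<circ> \<rho>) i) powi (\<kappa> i + int i - 1)) =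
        (\<Prod>i = 1..n. X (\<tau> (\<rho> i)) powi (k (\<rho> i) + int (\<rho> i) - 1 + p))"
      using \<kappa> by (intro prod.cong) (auto simp: algebra_simps)
    also have "\<dots> = (\<Prod>i = 1..n. X (\<tau> i) powi (k i + int i - 1 + p))"
      using prod.permute[OF \<rho>, of "\<lambda>i. X (\<tau> i) powi (k i + int i - 1 + p)"] by (simp add: comp_def)
    also have "\<dots> = (\<Prod>i = 1..n. X (\<tau> i) powi (k i + int i - 1) * X (\<tau> i) powi p)"
      using nz\<tau> by (intro prod.cong refl power_int_add) auto
    also have "\<dots> = ?g \<tau> * (\<Prod>i = 1..n. X i powi p)"
      using prod.permute[OF \<tau>, of "\<lambda>i. X i powi p"] by (simp add: prod.distrib comp_def)
    finally show "of_int (sign (\<tau> \<circ> \<rho>)) * (\<Prod>i = 1..n. X ((\<tau> \<circ> \<rho>) i) powi (\<kappa> i + int i - 1)) =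
      of_int (sign \<rho>) * (\<Prod>i = 1..n. X i powi p) * (of_int (sign \<tau>) * ?g \<tau>)"
      by (simp add: s)
  qed
  also have "\<dots> = of_int (sign \<rho>) * (\<Prod>i = 1..n. X i powi p) * alternant n trivial_weight X k"
    by (simp add: sum_distrib_left alternant_def alternant_term_def case_prod_unfold)
  finally show ?thesis .
qed

text \<open>This gives meaning to the \<open>THE\<close> in \<open>ext_schur\<close>.\<close>

lemma ex1_sorting_permutation:
  fixes v :: "nat \<Rightarrow> int"
  assumes inj: "inj_on v {1..n}"
  shows "\<exists>!\<sigma>. \<sigma> permutes {1..n} \<and> (\<forall>i j. 1 \<le> i \<and> i < j \<and> j \<le> n \<longrightarrow> v (\<sigma> j) < v (\<sigma> i))"
proof -
  \<comment> \<open>The rank of v i in decreasing order, counting v i itself; the sorting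
    permutation is the inverse.\<close>
  define \<rho> where "\<rho> i = (if i \<in> {1..n} then card {j\<in>{1..n}. v i \<le> v j} else i)" for i
  have less: "\<rho> i < \<rho> j" if "i \<in> {1..n}" "j \<in> {1..n}" "v j < v i" for i j
  proof -
    have "{l\<in>{1..n}. v i \<le> v l} \<subseteq> {l\<in>{1..n}. v j \<le> v l}"
      using that(3) by auto
    moreover have "j \<in> {l\<in>{1..n}. v j \<le> v l}" "j \<notin> {l\<in>{1..n}. v i \<le> v l}"
      using that by auto
    ultimately have "{l\<in>{1..n}. v i \<le> v l} \<subset> {l\<in>{1..n}. v j \<le> v l}"
      by blast
    then have "card {l\<in>{1..n}. v i \<le> v l} < card {l\<in>{1..n}. v j \<le> v l}"
      by (intro psubset_card_mono) auto
    then show ?thesis using that by (simp add: \<rho>_def)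
  qed
  have inj\<rho>: "inj_on \<rho> {1..n}"
  proof (rule inj_onI)
    fix i j assume ij: "i \<in> {1..n}" "j \<in> {1..n}" "\<rho> i = \<rho> j"
    then have "v i = v j" using less[of i j] less[of j i] by (cases "v i" "v j" rule: linorder_cases) auto
    then show "i = j" using inj_onD[OF inj] ij by blast
  qed
  have range: "\<rho> i \<in> {1..n}" if "i \<in> {1..n}" for i
  proof -
    have "card {j\<in>{1..n}. v i \<le> v j} \<le> card {1..n}" by (intro card_mono) auto
    moreover have "0 < card {j\<in>{1..n}. v i \<le> v j}"
      using that by (subst card_gt_0_iff) auto
    ultimately show ?thesis using that by (simp add: \<rho>_def)
  qed
  have "\<rho> ` {1..n} = {1..n}"
    using range by (intro endo_inj_surj inj\<rho>) auto
  then have \<rho>: "\<rho> permutes {1..n}"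
    using inj\<rho> by (intro bij_imp_permutes) (auto simp: bij_betw_def \<rho>_def)
  show ?thesis
  proof (rule ex1I[of _ "inv \<rho>"])
    have "v (inv \<rho> j) < v (inv \<rho> i)" if "1 \<le> i" "i < j" "j \<le> n" for i j
    proof (rule ccontr)
      have mem: "inv \<rho> i \<in> {1..n}" "inv \<rho> j \<in> {1..n}"
        using permutes_in_image[OF permutes_inv[OF \<rho>]] that by auto
      assume "\<not> v (inv \<rho> j) < v (inv \<rho> i)"
      then have "v (inv \<rho> i) < v (inv \<rho> j) \<or> inv \<rho> i = inv \<rho> j"
        using inj_onD[OF inj _ mem] by (cases "v (inv \<rho> i)" "v (inv \<rho> j)" rule: linorder_cases) auto
      then have "\<rho> (inv \<rho> j) \<le> \<rho> (inv \<rho> i)"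
        using less[OF mem(2,1)] by auto
      then show False using that by (simp add: permutes_inverses(1)[OF \<rho>])
    qed
    then show "inv \<rho> permutes {1..n} \<and> (\<forall>i j. 1 \<le> i \<and> i < j \<and> j \<le> n \<longrightarrow> v (inv \<rho> j) < v (inv \<rho> i))"
      using permutes_inv[OF \<rho>] by blast
  next
    fix \<sigma> assume "\<sigma> permutes {1..n} \<and> (\<forall>i j. 1 \<le> i \<and> i < j \<and> j \<le> n \<longrightarrow> v (\<sigma> j) < v (\<sigma> i))"
    then have \<sigma>: "\<sigma> permutes {1..n}" and dec: "\<And>i j. 1 \<le> i \<Longrightarrow> i < j \<Longrightarrow> j \<le> n \<Longrightarrow> v (\<sigma> j) < v (\<sigma> i)"
      by auto
    have "\<rho> (\<sigma> i) = i" for i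
    proof (cases "i \<in> {1..n}")
      case True
      have le: "v (\<sigma> i) \<le> v (\<sigma> j) \<longleftrightarrow> j \<le> i" if "j \<in> {1..n}" for j
        using dec[of i j] dec[of j i] True that by (cases i j rule: linorder_cases) auto
      have "{j\<in>{1..n}. v (\<sigma> i) \<le> v j} = \<sigma> ` {j\<in>{1..n}. v (\<sigma> i) \<le> v (\<sigma> j)}"
        by (subst permutes_image[OF \<sigma>, symmetric]) blast
      also have "card \<dots> = card {j\<in>{1..n}. v (\<sigma> i) \<le> v (\<sigma> j)}"
        by (intro card_image inj_on_subset[OF permutes_inj[OF \<sigma>]]) auto
      also have "{j\<in>{1..n}. v (\<sigma> i) \<le> v (\<sigma> j)} = {1..i}"
        using le True by auto
      finally show ?thesis
        using permutes_in_image[OF \<sigma>, of i] True by (simp add: \<rho>_def)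
    next
      case False
      then show ?thesis using permutes_not_in[OF \<sigma> False] by (auto simp: \<rho>_def)
    qed
    then show "\<sigma> = inv \<rho>"
      using permutes_inv_eq[OF \<rho>] by (metis ext)
  qed
qed

text \<open>\<open>ext_schur\<close> vanishes, changes sign and scales exactly as the alternant
  does, so the formula extends from partitions to all integer sequences.\<close>

lemma ext_schur_alternant:
  fixes X :: "nat \<Rightarrow> 'a::field"
  assumes inj: "inj_on X {1..n}" and nz: "\<And>i. i \<in> {1..n} \<Longrightarrow> X i \<noteq> 0"
  shows "ext_schur n (\<lambda>i. k (n + 1 - i)) X = alternant n trivial_weight X k / vandermonde n X"
proof (cases "\<exists>i j. 1 \<le> i \<and> i < j \<and> j \<le> n \<and> k (n + 1 - i) - int i = k (n + 1 - j) - int j")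
  case True
  then obtain i j where ij: "1 \<le> i" "i < j" "j \<le> n" "k (n + 1 - i) - int i = k (n + 1 - j) - int j" by blast
  have "alternant n trivial_weight X k = 0"
    by (rule alternant_eq_0[of "n + 1 - i" _ "n + 1 - j"]) (use ij in \<open>auto simp: of_nat_diff\<close>)
  then show ?thesis using True by (simp add: ext_schur_def)
next
  case False
  define lam where "lam i = k (n + 1 - i)" for i
  define v where "v i = lam i - int i" for i
  have injv: "inj_on v {1..n}"
    using False by (intro linorder_inj_onI) (auto simp: v_def lam_def)
  define \<sigma> where "\<sigma> = (THE \<sigma>. \<sigma> permutes {1..n} \<and>
      (\<forall>i j. 1 \<le> i \<and> i < j \<and> j \<le> n \<longrightarrow> lam (\<sigma> i) - int (\<sigma> i) > lam (\<sigma> j) - int (\<sigma> j)))"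
  have "\<sigma> permutes {1..n} \<and> (\<forall>i j. 1 \<le> i \<and> i < j \<and> j \<le> n \<longrightarrow> lam (\<sigma> j) - int (\<sigma> j) < lam (\<sigma> i) - int (\<sigma> i))"
    unfolding \<sigma>_def using theI'[OF ex1_sorting_permutation[OF injv, unfolded v_def]] .
  then have \<sigma>: "\<sigma> permutes {1..n}"
    and dec: "\<And>i j. 1 \<le> i \<Longrightarrow> i < j \<Longrightarrow> j \<le> n \<Longrightarrow> lam (\<sigma> j) - int (\<sigma> j) < lam (\<sigma> i) - int (\<sigma> i)"
    by auto
  define p where "p = nat (- (lam (\<sigma> n) + int n - int (\<sigma> n)))"
  define mu where "mu i = nat (lam (\<sigma> i) + int i - int (\<sigma> i) + int p)" for i
  \<comment> \<open>A strictly decreasing integer sequence stays weakly decreasing after adding i.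
    So the last part is the smallest, and p makes all parts nonnegative.\<close>
  have mono: "lam (\<sigma> j) + int j - int (\<sigma> j) \<le> lam (\<sigma> i) + int i - int (\<sigma> i)"
    if "1 \<le> i" "i \<le> j" "j \<le> n" for i j
    using that(2,3)
  proof (induction j rule: dec_induct)
    case (step j)
    then show ?case using dec[of j "Suc j"] that(1) by auto
  qed simp
  have mu: "int (mu i) = lam (\<sigma> i) + int i - int (\<sigma> i) + int p" if "i \<in> {1..n}" for i
    using mono[of i n] that by (auto simp: mu_def p_def)
  have mu_dec: "mu (Suc i) \<le> mu i" if "1 \<le> i" "i < n" for i
    using mono[of i "Suc i"] that by (auto simp: mu_def)
  \<comment> \<open>\<open>ext_schur\<close> sorts the reversed sequence while the alternant is
    indexed by k itself. The sorting permutation is therefore conjugated by the reversal w, which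
    preserves its sign.\<close>
  define w where "w i = (if i \<in> {1..n} then n + 1 - i else i)" for i
  have w: "w permutes {1..n}"
    by (rule bij_imp_permutes, rule bij_betw_byWitness[where f' = w]) (auto simp: w_def)
  define \<rho> where "\<rho> = w \<circ> \<sigma> \<circ> w"
  have \<rho>: "\<rho> permutes {1..n}"
    unfolding \<rho>_def using \<sigma> w by (intro permutes_compose)
  have perm: "permutation w" "permutation \<sigma>"
    using w \<sigma> by (auto intro: permutes_imp_permutation[of "{1..n}"])
  have "sign w * sign w = 1" by simp
  then have sign: "sign \<rho> = sign \<sigma>"
    unfolding \<rho>_def using perm by (simp add: sign_compose permutation_compose)
  have \<kappa>: "int (mu (n + 1 - i)) + int i = k (\<rho> i) + int (\<rho> i) + int p" if i: "i \<in> {1..n}" for i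
  proof -
    let ?j = "n + 1 - i"
    have j: "?j \<in> {1..n}" using i by auto
    have \<sigma>j: "\<sigma> ?j \<in> {1..n}" using permutes_in_image[OF \<sigma>, of ?j] j by simp
    then have "\<rho> i = n + 1 - \<sigma> ?j" using i by (simp add: \<rho>_def w_def)
    then show ?thesis using mu[OF j] \<sigma>j i by (auto simp: lam_def of_nat_diff)
  qed
  have "ext_schur n lam X = of_int (sign \<sigma>) * schur n mu X * (\<Prod>i = 1..n. X i powi (- int p))"
    unfolding ext_schur_def Let_def if_not_P[OF False [folded lam_def]] \<sigma>_def [symmetric] p_def [symmetric]
      mu_def [abs_def, symmetric] by (rule refl)
  also have "schur n mu X = alternant n trivial_weight X (\<lambda>i. int (mu (n + 1 - i))) / vandermonde n X"
    by (rule schur_alternant[where mu = mu, OF inj nz mu_dec])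
  also have "alternant n trivial_weight X (\<lambda>i. int (mu (n + 1 - i))) =
      of_int (sign \<rho>) * (\<Prod>i = 1..n. X i powi int p) * alternant n trivial_weight X k"
    by (rule alternant_permute[OF \<rho> nz \<kappa>])
  also have "of_int (sign \<sigma>) * (of_int (sign \<rho>) * (\<Prod>i = 1..n. X i powi int p) * alternant n trivial_weight X k / vandermonde n X) *
      (\<Prod>i = 1..n. X i powi (- int p)) =
      of_int (sign \<sigma> * sign \<rho>) * (\<Prod>i = 1..n. X i powi int p * X i powi (- int p)) * (alternant n trivial_weight X k / vandermonde n X)"
    by (simp add: prod.distrib)
  also have "(\<Prod>i = 1..n. X i powi int p * X i powi (- int p)) = 1"
    using nz by (intro prod.neutral) (auto simp: power_int_minus)
  finally show ?thesis
    by (simp add: sign lam_def [abs_def])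
qed

section \<open>Specialization from pairwise distinct variables\<close>

text \<open>The denominators of the alternant formula vanish when variables coincide. So the identity is
  transported from Laurent series in t, with the distinct variables X i + t ^ i, by setting t = 0.\<close>
definition specializes :: "'a::field fls \<Rightarrow> 'a \<Rightarrow> bool" where
  "specializes F c \<longleftrightarrow> (\<exists>g. F = fps_to_fls g \<and> fps_nth g 0 = c)"

text \<open>Setting t = 0 makes sense only for series without a pole, so it is a relation;
  uniqueness of the value turns it back into an equation at the end.\<close>

lemma specializes_unique: "specializes F c \<Longrightarrow> specializes F c' \<Longrightarrow> c = c'"
  by (auto simp: specializes_def)

lemma specializes_fps: "specializes (fps_to_fls g) (fps_nth g 0)"
  by (auto simp: specializes_def)

lemma specializes_0: "specializes 0 0"
  using specializes_fps[of 0] by simp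

lemma specializes_1: "specializes 1 1"
  using specializes_fps[of 1] by simp

lemma specializes_of_int: "specializes (of_int i) (of_int i)"
  using specializes_fps[of "fps_const (of_int i)"] by (simp add: fls_of_int)

lemma specializes_uminus: "specializes F c \<Longrightarrow> specializes (- F) (- c)"
  unfolding specializes_def by (metis fps_to_fls_uminus fps_neg_nth)

lemma specializes_add: "specializes F c \<Longrightarrow> specializes G d \<Longrightarrow> specializes (F + G) (c + d)"
  unfolding specializes_def by (metis fps_to_fls_plus fps_add_nth)

lemma specializes_mult: "specializes F c \<Longrightarrow> specializes G d \<Longrightarrow> specializes (F * G) (c * d)"
  unfolding specializes_def by (metis fls_times_fps_to_fls fps_mult_nth_0)

text \<open>A nonzero constant term makes g a unit among power series, so the inverse has no
  pole.\<close>

lemma specializes_inverse: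
  assumes "specializes F c" "c \<noteq> 0"
  shows "specializes (inverse F) (inverse c)"
proof -
  from assms obtain g where g: "F = fps_to_fls g" "fps_nth g 0 = c"
    by (auto simp: specializes_def)
  have "F * fps_to_fls (inverse g) = fps_to_fls (g * inverse g)"
    by (simp add: g fls_times_fps_to_fls)
  also have "g * inverse g = 1"
    using g assms(2) by (simp add: inverse_mult_eq_1')
  finally have "inverse F = fps_to_fls (inverse g)"
    by (simp add: inverse_unique)
  then show ?thesis
    using g specializes_fps[of "inverse g"] by simp
qed

lemma specializes_sum: "(\<And>x. x \<in> A \<Longrightarrow> specializes (f x) (g x)) \<Longrightarrow> specializes (\<Sum>x\<in>A. f x) (\<Sum>x\<in>A. g x)"
  by (induction A rule: infinite_finite_induct) (auto intro: specializes_0 specializes_add)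

lemma specializes_prod: "(\<And>x. x \<in> A \<Longrightarrow> specializes (f x) (g x)) \<Longrightarrow> specializes (\<Prod>x\<in>A. f x) (\<Prod>x\<in>A. g x)"
  by (induction A rule: infinite_finite_induct) (auto intro: specializes_1 specializes_mult)

lemma specializes_power: "specializes F c \<Longrightarrow> specializes (F ^ m) (c ^ m)"
  by (induction m) (auto intro: specializes_1 specializes_mult)

lemma specializes_powi: "specializes F c \<Longrightarrow> c \<noteq> 0 \<Longrightarrow> specializes (F powi m) (c powi m)"
  by (auto simp: power_int_def intro: specializes_power specializes_inverse)

lemmas specializes_intros = specializes_0 specializes_1 specializes_of_int specializes_uminus
  specializes_add specializes_mult specializes_inverse specializes_sum specializes_prod
  specializes_power specializes_powi

text \<open>The set of triangles depends only on k, so the two sums are compared term by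
  term.\<close>

lemma specializes_gen_fun:
  assumes "\<And>a. specializes (\<Omega> a) (\<omega> a)"
    and "\<And>i. i \<in> {1..n} \<Longrightarrow> specializes (Y i) (X i) \<and> X i \<noteq> 0"
  shows "specializes (gen_fun n \<Omega> Y k) (gen_fun n \<omega> X k)"
  unfolding gen_fun_def tri_weight_def case_prod_unfold
  using assms by (intro specializes_intros) auto

lemma specializes_schur:
  assumes "\<And>i. i \<in> {1..n} \<Longrightarrow> specializes (Y i) (X i)"
  shows "specializes (schur n mu Y) (schur n mu X)"
  unfolding schur_def case_prod_unfold
  by (intro specializes_sum specializes_prod assms) (auto simp: SSYT_def)

text \<open>The sorting permutation, the shift and the shape depend on \<open>lam\<close> alone and
  agree on both sides.\<close>

lemma specializes_ext_schur:
  assumes "\<And>i. i \<in> {1..n} \<Longrightarrow> specializes (Y i) (X i) \<and> X i \<noteq> 0"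
  shows "specializes (ext_schur n lam Y) (ext_schur n lam X)"
  unfolding ext_schur_def Let_def
  using assms by (auto intro!: specializes_intros specializes_schur)

lemma specializes_op_prod:
  assumes \<omega>: "\<And>a. specializes (\<Omega> a) (\<omega> a)" and f: "\<And>k. specializes (f k) (g k)"
  shows "specializes (op_prod n \<Omega> f k) (op_prod n \<omega> g k)"
proof -
  have "specializes (foldr (\<lambda>(p, q) g. pair_op \<Omega> p q g) ps f k) (foldr (\<lambda>(p, q) g. pair_op \<omega> p q g) ps g k)" for ps k
    using f \<omega> by (induction ps arbitrary: k) (auto simp: pair_op_def intro!: specializes_add specializes_mult)
  then show ?thesis by (simp add: op_prod_def)
qed

lemma gen_fun_eq_op_prod_distinct:
  fixes X :: "nat \<Rightarrow> 'a::field"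
  assumes "inj_on X {1..n}" "\<And>i. i \<in> {1..n} \<Longrightarrow> X i \<noteq> 0"
  shows "gen_fun n \<omega> X k =
    (\<Prod>i = 1..n. \<omega> NE * X i + \<omega> NW * inverse (X i) + \<omega> NWNE + \<omega> Empty) *
    op_prod n \<omega> (\<lambda>k'. ext_schur n (\<lambda>i. k' (n + 1 - i)) X) k"
proof -
  \<comment> \<open>For equal arguments the \<open>NWNE\<close> term is X i * inverse (X i) =
    1.\<close>
  have "(\<Prod>i = 1..n. arrow_factor \<omega> (X i) (X i)) =
      (\<Prod>i = 1..n. \<omega> NE * X i + \<omega> NW * inverse (X i) + \<omega> NWNE + \<omega> Empty)"
    using assms(2) by (intro prod.cong) (auto simp: arrow_factor_def)
  moreover have "(\<lambda>k'. ext_schur n (\<lambda>i. k' (n + 1 - i)) X) = (\<lambda>k'. alternant n trivial_weight X k' / vandermonde n X)"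
    by (intro ext ext_schur_alternant assms)
  ultimately show ?thesis
    using gen_fun_alternant[OF assms] op_prod_alternant[OF assms(2)] by simp
qed

theorem mainTheorem8:
  fixes n :: nat and k :: "nat \<Rightarrow> int" and \<omega> :: "arrow \<Rightarrow> 'a::field" and X :: "nat \<Rightarrow> 'a"
  assumes "\<And>i. 1 \<le> i \<Longrightarrow> i \<le> n \<Longrightarrow> X i \<noteq> 0"
  shows "gen_fun n \<omega> X k =
    (\<Prod>i = 1..n. \<omega> NE * X i + \<omega> NW * inverse (X i) + \<omega> NWNE + \<omega> Empty) *
    op_prod n \<omega> (\<lambda>k'. ext_schur n (\<lambda>i. k' (n + 1 - i)) X) k"
proof -
  define \<Omega> where "\<Omega> a = fps_to_fls (fps_const (\<omega> a))" for a
  \<comment> \<open>The perturbations t^i vanish at t = 0 because i >= 1. They make the variables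
    distinct even if the X i coincide: only Y i has a nonzero coefficient at t^i.\<close>
  define Y where "Y i = fps_to_fls (fps_const (X i) + fps_X ^ i)" for i
  have \<Omega>: "specializes (\<Omega> a) (\<omega> a)" for a
    using specializes_fps[of "fps_const (\<omega> a)"] by (simp add: \<Omega>_def)
  have Y: "specializes (Y i) (X i) \<and> X i \<noteq> 0" if "i \<in> {1..n}" for i
    using specializes_fps[of "fps_const (X i) + fps_X ^ i"] that assms[of i] by (simp add: Y_def)
  have Y_nz: "Y i \<noteq> 0" if "i \<in> {1..n}" for i
    using Y[OF that] specializes_unique[of "Y i" "X i" 0] specializes_0 by auto
  have inj: "inj_on Y {1..n}"
  proof (rule inj_onI)
    fix i j assume ij: "i \<in> {1..n}" "j \<in> {1..n}" "Y i = Y j"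
    then have "fps_const (X i) + fps_X ^ i = fps_const (X j) + fps_X ^ j"
      by (simp only: Y_def fps_to_fls_eq_iff)
    then have "fps_nth (fps_const (X i) + fps_X ^ i) i = fps_nth (fps_const (X j) + fps_X ^ j) i"
      by (rule arg_cong)
    then show "i = j" using ij by (simp add: fps_X_power_nth split: if_splits)
  qed
  have eq: "gen_fun n \<Omega> Y k =
     (\<Prod>i = 1..n. \<Omega> NE * Y i + \<Omega> NW * inverse (Y i) + \<Omega> NWNE + \<Omega> Empty) *
      op_prod n \<Omega> (\<lambda>k'. ext_schur n (\<lambda>i. k' (n + 1 - i)) Y) k"
    by (rule gen_fun_eq_op_prod_distinct[OF inj]) (rule Y_nz)
  have "specializes (gen_fun n \<Omega> Y k)
     ((\<Prod>i = 1..n. \<omega> NE * X i + \<omega> NW * inverse (X i) + \<omega> NWNE + \<omega> Empty) *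
      op_prod n \<omega> (\<lambda>k'. ext_schur n (\<lambda>i. k' (n + 1 - i)) X) k)"
    unfolding eq
    by (intro specializes_mult specializes_prod specializes_add specializes_inverse specializes_op_prod
        specializes_ext_schur \<Omega>) (use Y in auto)
  then show ?thesis
    using specializes_gen_fun[of \<Omega> \<omega> n Y X k] \<Omega> Y specializes_unique by blast
qed

end
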